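(* Let $(M,g)$ be a smooth Riemannian manifold of dimension $n>1$, and let $J$ be the natural almost complex structure of diagonal type on $T^*M$ determined by smooth functions $a_1,a_2,b_1,b_2:[0,\infty)\to\mathbb{R}$ satisfying $a_1a_2=1$, $(a_1+2tb_1)(a_2+2tb_2)=1$ and $a_1>0$, $a_2>0$, $a_1+2tb_1>0$, $a_2+2tb_2>0$ for all $t\ge 0$. Then $J$ is integrable if and only if there is a constant $c$ such that $(M,g)$ has constant sectional curvature $c$ and the function $b_1$ is given by $$b_1=\frac{a_1a_1'-c}{a_1-2ta_1'}.$$
   Context: Let $(M,g)$ be an $n$-dimensional Riemannian manifold and $\pi:T^*M\to M$ its cotangent bundle. A local chart $(U,x^1,\dots,x^n)$ of $M$ induces a chart $(\pi^{-1}(U),q^1,\dots,q^n,p_1,\dots,p_n)$ of $T^*M$ with $q^i=x^i\circ\pi$ and $p=p_i\,dx^i_{\pi(p)}$. Summation convention is used. Let $\Gamma^k_{ij}$ be the Christoffel symbols of the Levi-Civita connection of $g$, $(g^{ij})$ the inverse matrix of $(g_{ij})$, $\Gamma^0_{ih}=p_k\Gamma^k_{ih}$, $g^{0i}=p_hg^{hi}$, $\partial^i=\partial/\partial p_i$ and $\delta_i=\partial/\partial q^i+\Gamma^0_{ih}\,\partial/\partial p_h$. Then $(\partial^1,\dots,\partial^n,\delta_1,\dots,\delta_n)$ is a local frame on $T^*M$ (adapted to the splitting into vertical and horizontal distributions). Let $t=\frac12 g^{ik}p_ip_k\in[0,\infty)$ be the energy density; functions of $t$ are regarded as functions on $T^*M$,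 and a prime denotes $d/dt$. The tensor field $J$ of type $(1,1)$ on $T^*M$ determined by $a_1,a_2,b_1,b_2$ is $$J\delta_i=a_1(t)g_{ij}\partial^j+b_1(t)p_ip_j\partial^j,\qquad J\partial^i=-a_2(t)g^{ij}\delta_j-b_2(t)g^{0i}g^{0j}\delta_j.$$ Under the relations $a_1a_2=1$, $(a_1+2tb_1)(a_2+2tb_2)=1$ one has $J^2=-I$, and $J$ is called a natural almost complex structure of diagonal type. Integrable means that the Nijenhuis tensor $N(X,Y)=[JX,JY]-J[JX,Y]-J[X,JY]-[X,Y]$ vanishes. The formula for $b_1$ is understood to include that its denominator vanishes nowhere. All objects are smooth. *)

theory Defs
  imports "HOL-Analysis.Analysis"
begin

section \<open>Smooth functions\<close>

text \<open>Used for open sets \<open>S\<close> and for \<open>S = {0..}\<close> in the reals; in both cases the derivative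
  within \<open>S\<close> is unique at every point of \<open>S\<close> (one-sided at \<open>0\<close> in the second case).\<close>

primrec Ck_on :: "nat \<Rightarrow> 'a::euclidean_space set \<Rightarrow> ('a \<Rightarrow> 'b::real_normed_vector) \<Rightarrow> bool" where
  "Ck_on 0 S f \<longleftrightarrow> continuous_on S f"
| "Ck_on (Suc k) S f \<longleftrightarrow> f differentiable_on S \<and>
     (\<forall>v. Ck_on k S (\<lambda>x. frechet_derivative f (at x within S) v))"

definition smooth_on :: "'a::euclidean_space set \<Rightarrow> ('a \<Rightarrow> 'b::real_normed_vector) \<Rightarrow> bool" where
  "smooth_on S f \<longleftrightarrow> (\<forall>k. Ck_on k S f)"

text \<open>The derivative of a function on \<open>[0,\<infinity>)\<close>; values at negative arguments play no role.\<close>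

definition ddt :: "(real \<Rightarrow> real) \<Rightarrow> real \<Rightarrow> real" where
  "ddt f t = vector_derivative f (at t within {0..})"


section \<open>Smooth manifolds\<close>

text \<open>An atlas is a family of charts indexed by a type. The charts need not be pairwise distinct,
  so every nonempty set of charts can be presented in this way. The point set is the union of the
  chart domains, and its topology is the one induced by the charts. The value of a chart map
  outside its domain is irrelevant.\<close>

record ('i, 'p, 'e) atlas =
  chart_dom :: "'i \<Rightarrow> 'p set"
  chart_map :: "'i \<Rightarrow> 'p \<Rightarrow> 'e"

definition points :: "('i, 'p, 'e) atlas \<Rightarrow> 'p set" where
  "points A = (\<Union>\<alpha>. chart_dom A \<alpha>)"

definition chart_img :: "('i, 'p, 'e) atlas \<Rightarrow> 'i \<Rightarrow> 'e set" where
  "chart_img A \<alpha> = chart_map A \<alpha> ` chart_dom A \<alpha>"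

definition chart_inv :: "('i, 'p, 'e) atlas \<Rightarrow> 'i \<Rightarrow> 'e \<Rightarrow> 'p" where
  "chart_inv A \<alpha> = inv_into (chart_dom A \<alpha>) (chart_map A \<alpha>)"

definition transition :: "('i, 'p, 'e) atlas \<Rightarrow> 'i \<Rightarrow> 'i \<Rightarrow> 'e \<Rightarrow> 'e" where
  "transition A \<alpha> \<beta> = chart_map A \<beta> \<circ> chart_inv A \<alpha>"

definition atlas_topology :: "('i, 'p, 'e::euclidean_space) atlas \<Rightarrow> 'p topology" where
  "atlas_topology A = topology (\<lambda>W. W \<subseteq> points A \<and>
     (\<forall>\<alpha>. open (chart_map A \<alpha> ` (W \<inter> chart_dom A \<alpha>))))"

definition smooth_manifold :: "('i, 'p, 'e::euclidean_space) atlas \<Rightarrow> bool" where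
  "smooth_manifold A \<longleftrightarrow>
     points A \<noteq> {} \<and>
     (\<forall>\<alpha>. inj_on (chart_map A \<alpha>) (chart_dom A \<alpha>)) \<and>
     (\<forall>\<alpha> \<beta>. open (chart_map A \<alpha> ` (chart_dom A \<alpha> \<inter> chart_dom A \<beta>)) \<and>
            smooth_on (chart_map A \<alpha> ` (chart_dom A \<alpha> \<inter> chart_dom A \<beta>)) (transition A \<alpha> \<beta>)) \<and>
     Hausdorff_space (atlas_topology A) \<and>
     second_countable (atlas_topology A)"

text \<open>A tangent vector at \<open>p\<close> is given by its components in all charts around \<open>p\<close>, related by the
  differentials of the coordinate changes; it is \<open>0\<close> at the indices of all other charts, so that
  equality of tangent vectors is equality of functions.\<close>

definition tangent_space :: "('i, 'p, 'e::euclidean_space) atlas \<Rightarrow> 'p \<Rightarrow> ('i \<Rightarrow> 'e) set" where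
  "tangent_space A p = {v.
     (\<forall>\<alpha> \<beta>. p \<in> chart_dom A \<alpha> \<inter> chart_dom A \<beta> \<longrightarrow>
        v \<beta> = frechet_derivative (transition A \<alpha> \<beta>) (at (chart_map A \<alpha> p)) (v \<alpha>)) \<and>
     (\<forall>\<alpha>. p \<notin> chart_dom A \<alpha> \<longrightarrow> v \<alpha> = 0)}"

text \<open>The tangent vector at \<open>p\<close> whose components in the chart \<open>\<alpha>\<close> are \<open>e\<close>. In particular
  \<open>coord_vector A \<alpha> p (axis i 1)\<close> is the coordinate vector \<open>\<partial>/\<partial>x\<^sup>i\<close> at \<open>p\<close>.\<close>

definition coord_vector ::
    "('i, 'p, 'e::euclidean_space) atlas \<Rightarrow> 'i \<Rightarrow> 'p \<Rightarrow> 'e \<Rightarrow> ('i \<Rightarrow> 'e)" where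
  "coord_vector A \<alpha> p e = (\<lambda>\<beta>. if p \<in> chart_dom A \<beta>
     then frechet_derivative (transition A \<alpha> \<beta>) (at (chart_map A \<alpha> p)) e else 0)"

definition linear_form_on :: "('i \<Rightarrow> 'e::real_vector) set \<Rightarrow> (('i \<Rightarrow> 'e) \<Rightarrow> real) \<Rightarrow> bool" where
  "linear_form_on T f \<longleftrightarrow> (\<forall>v\<in>T. \<forall>w\<in>T. \<forall>r. f (\<lambda>\<alpha>. r *\<^sub>R v \<alpha> + w \<alpha>) = r * f v + f w)"


section \<open>Vector fields, Lie bracket, Nijenhuis tensor\<close>

definition vector_field_on ::
    "('i, 'p, 'e::euclidean_space) atlas \<Rightarrow> 'p set \<Rightarrow> ('p \<Rightarrow> 'i \<Rightarrow> 'e) \<Rightarrow> bool" where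
  "vector_field_on A W X \<longleftrightarrow>
     (\<forall>p\<in>W. X p \<in> tangent_space A p) \<and>
     (\<forall>\<alpha>. smooth_on (chart_map A \<alpha> ` (W \<inter> chart_dom A \<alpha>)) (\<lambda>z. X (chart_inv A \<alpha> z) \<alpha>))"

text \<open>In coordinates, \<open>[X,Y]\<^sup>k = X\<^sup>i \<partial>\<^sub>i Y\<^sup>k - Y\<^sup>i \<partial>\<^sub>i X\<^sup>k\<close>.\<close>

definition lie_bracket ::
    "('i, 'p, 'e::euclidean_space) atlas \<Rightarrow> ('p \<Rightarrow> 'i \<Rightarrow> 'e) \<Rightarrow> ('p \<Rightarrow> 'i \<Rightarrow> 'e) \<Rightarrow> ('p \<Rightarrow> 'i \<Rightarrow> 'e)" where
  "lie_bracket A X Y = (\<lambda>p \<alpha>. if p \<in> chart_dom A \<alpha>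
     then frechet_derivative (\<lambda>z. Y (chart_inv A \<alpha> z) \<alpha>) (at (chart_map A \<alpha> p)) (X p \<alpha>)
        - frechet_derivative (\<lambda>z. X (chart_inv A \<alpha> z) \<alpha>) (at (chart_map A \<alpha> p)) (Y p \<alpha>)
     else 0)"

definition nijenhuis ::
    "('i, 'p, 'e::euclidean_space) atlas \<Rightarrow> ('p \<Rightarrow> ('i \<Rightarrow> 'e) \<Rightarrow> ('i \<Rightarrow> 'e)) \<Rightarrow>
     ('p \<Rightarrow> 'i \<Rightarrow> 'e) \<Rightarrow> ('p \<Rightarrow> 'i \<Rightarrow> 'e) \<Rightarrow> ('p \<Rightarrow> 'i \<Rightarrow> 'e)" where
  "nijenhuis A J X Y = (let JX = (\<lambda>p. J p (X p)); JY = (\<lambda>p. J p (Y p)) in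
     (\<lambda>p \<alpha>. lie_bracket A JX JY p \<alpha> - J p (lie_bracket A JX Y p) \<alpha>
           - J p (lie_bracket A X JY p) \<alpha> - lie_bracket A X Y p \<alpha>))"

text \<open>Since \<open>N\<close> is a tensor, its vanishing may be tested on local vector fields.\<close>

definition integrable_structure ::
    "('i, 'p, 'e::euclidean_space) atlas \<Rightarrow> ('p \<Rightarrow> ('i \<Rightarrow> 'e) \<Rightarrow> ('i \<Rightarrow> 'e)) \<Rightarrow> bool" where
  "integrable_structure A J \<longleftrightarrow>
     (\<forall>W X Y. openin (atlas_topology A) W \<and> vector_field_on A W X \<and> vector_field_on A W Y \<longrightarrow>
        (\<forall>p\<in>W. nijenhuis A J X Y p = (\<lambda>\<alpha>. 0)))"


section \<open>Riemannian metrics and curvature\<close>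

definition metric_coeff ::
    "('i, 'm, real^'n) atlas \<Rightarrow> ('m \<Rightarrow> ('i \<Rightarrow> real^'n) \<Rightarrow> ('i \<Rightarrow> real^'n) \<Rightarrow> real) \<Rightarrow>
     'i \<Rightarrow> real^'n \<Rightarrow> real^'n^'n" where
  "metric_coeff A g \<alpha> q = (let m = chart_inv A \<alpha> q in
     (\<chi> i j. g m (coord_vector A \<alpha> m (axis i 1)) (coord_vector A \<alpha> m (axis j 1))))"

definition riemannian_metric ::
    "('i, 'm, real^'n) atlas \<Rightarrow> ('m \<Rightarrow> ('i \<Rightarrow> real^'n) \<Rightarrow> ('i \<Rightarrow> real^'n) \<Rightarrow> real) \<Rightarrow> bool" where
  "riemannian_metric A g \<longleftrightarrow>
     (\<forall>m\<in>points A.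
        (\<forall>v\<in>tangent_space A m. linear_form_on (tangent_space A m) (g m v)) \<and>
        (\<forall>v\<in>tangent_space A m. \<forall>w\<in>tangent_space A m. g m v w = g m w v) \<and>
        (\<forall>v\<in>tangent_space A m. v \<noteq> (\<lambda>\<alpha>. 0) \<longrightarrow> g m v v > 0)) \<and>
     (\<forall>\<alpha> i j. smooth_on (chart_img A \<alpha>) (\<lambda>q. metric_coeff A g \<alpha> q $ i $ j))"

definition partial :: "'n::finite \<Rightarrow> (real^'n \<Rightarrow> real) \<Rightarrow> real^'n \<Rightarrow> real" where
  "partial i f q = frechet_derivative f (at q) (axis i 1)"

text \<open>In this and the following definitions \<open>G\<close> is the matrix of components of the metric in a
  chart, as a function of the coordinates. \<open>christoffel G q k i j\<close> is \<open>\<Gamma>\<^sup>k\<^sub>i\<^sub>j\<close>.\<close>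

definition christoffel :: "(real^'n \<Rightarrow> real^'n^'n) \<Rightarrow> real^'n \<Rightarrow> 'n \<Rightarrow> 'n \<Rightarrow> 'n \<Rightarrow> real" where
  "christoffel G q k i j = (1/2) * (\<Sum>l\<in>UNIV. matrix_inv (G q) $ k $ l *
     (partial i (\<lambda>q. G q $ j $ l) q + partial j (\<lambda>q. G q $ i $ l) q
        - partial l (\<lambda>q. G q $ i $ j) q))"

text \<open>\<open>riemann G q l k i j\<close> is the \<open>l\<close>-th component of \<open>R(\<partial>\<^sub>i,\<partial>\<^sub>j)\<partial>\<^sub>k\<close>, where
  \<open>R(X,Y)Z = \<nabla>\<^sub>X\<nabla>\<^sub>Y Z - \<nabla>\<^sub>Y\<nabla>\<^sub>X Z - \<nabla>\<^bsub>[X,Y]\<^esub> Z\<close>.\<close>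

definition riemann :: "(real^'n \<Rightarrow> real^'n^'n) \<Rightarrow> real^'n \<Rightarrow> 'n \<Rightarrow> 'n \<Rightarrow> 'n \<Rightarrow> 'n \<Rightarrow> real" where
  "riemann G q l k i j =
     partial i (\<lambda>q. christoffel G q l j k) q - partial j (\<lambda>q. christoffel G q l i k) q +
     (\<Sum>s\<in>UNIV. christoffel G q l i s * christoffel G q s j k
             - christoffel G q l j s * christoffel G q s i k)"

text \<open>\<open>K(u,v) = g(R(u,v)v,u) / (g(u,u)g(v,v) - g(u,v)\<^sup>2)\<close>, positive on round spheres.\<close>

definition sectional_curvature ::
    "(real^'n \<Rightarrow> real^'n^'n) \<Rightarrow> real^'n \<Rightarrow> real^'n \<Rightarrow> real^'n \<Rightarrow> real" where
  "sectional_curvature G q u v =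
     (let Ruvv = (\<chi> l. \<Sum>i\<in>UNIV. \<Sum>j\<in>UNIV. \<Sum>k\<in>UNIV. riemann G q l k i j * u$i * v$j * v$k);
          ip = (\<lambda>x y. x \<bullet> (G q *v y))
      in ip Ruvv u / (ip u u * ip v v - (ip u v)\<^sup>2))"

definition constant_sectional_curvature ::
    "('i, 'm, real^'n) atlas \<Rightarrow> ('m \<Rightarrow> ('i \<Rightarrow> real^'n) \<Rightarrow> ('i \<Rightarrow> real^'n) \<Rightarrow> real) \<Rightarrow> real \<Rightarrow> bool" where
  "constant_sectional_curvature A g c \<longleftrightarrow>
     (\<forall>\<alpha>. \<forall>m\<in>chart_dom A \<alpha>. \<forall>u\<in>tangent_space A m. \<forall>v\<in>tangent_space A m.
        u \<alpha> \<noteq> v \<alpha> \<and> independent {u \<alpha>, v \<alpha>} \<longrightarrow>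
        sectional_curvature (metric_coeff A g \<alpha>) (chart_map A \<alpha> m) (u \<alpha>) (v \<alpha>) = c)"


section \<open>The cotangent bundle\<close>

text \<open>Covectors are extended by \<open>0\<close> outside the tangent space, so that equality of covectors is
  equality of functions.\<close>

definition cotangent_space ::
    "('i, 'm, 'e::euclidean_space) atlas \<Rightarrow> 'm \<Rightarrow> (('i \<Rightarrow> 'e) \<Rightarrow> real) set" where
  "cotangent_space A m = {\<xi>. linear_form_on (tangent_space A m) \<xi> \<and>
     (\<forall>v. v \<notin> tangent_space A m \<longrightarrow> \<xi> v = 0)}"

text \<open>The atlas of induced charts \<open>(q,p)\<close>, where \<open>q = x \<circ> \<pi>\<close> and \<open>p\<^sub>i = \<xi>(\<partial>/\<partial>x\<^sup>i)\<close>, that is,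
  \<open>\<xi> = p\<^sub>i dx\<^sup>i\<close>.\<close>

definition cotangent_bundle ::
    "('i, 'm, real^'n) atlas \<Rightarrow>
     ('i, 'm \<times> (('i \<Rightarrow> real^'n) \<Rightarrow> real), (real^'n) \<times> (real^'n)) atlas" where
  "cotangent_bundle A =
     \<lparr> chart_dom = (\<lambda>\<alpha>. {(m, \<xi>). m \<in> chart_dom A \<alpha> \<and> \<xi> \<in> cotangent_space A m}),
       chart_map = (\<lambda>\<alpha> (m, \<xi>). (chart_map A \<alpha> m, \<chi> i. \<xi> (coord_vector A \<alpha> m (axis i 1)))) \<rparr>"


section \<open>Natural almost complex structures of diagonal type\<close>

definition Gamma0 :: "(real^'n \<Rightarrow> real^'n^'n) \<Rightarrow> (real^'n) \<times> (real^'n) \<Rightarrow> 'n \<Rightarrow> 'n \<Rightarrow> real" where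
  "Gamma0 G = (\<lambda>(q, p) i h. \<Sum>k\<in>UNIV. p$k * christoffel G q k i h)"

definition g0 :: "(real^'n \<Rightarrow> real^'n^'n) \<Rightarrow> (real^'n) \<times> (real^'n) \<Rightarrow> 'n \<Rightarrow> real" where
  "g0 G = (\<lambda>(q, p) i. \<Sum>h\<in>UNIV. p$h * matrix_inv (G q) $ h $ i)"

definition energy :: "(real^'n \<Rightarrow> real^'n^'n) \<Rightarrow> (real^'n) \<times> (real^'n) \<Rightarrow> real" where
  "energy G = (\<lambda>(q, p). (1/2) * (\<Sum>i\<in>UNIV. \<Sum>k\<in>UNIV. matrix_inv (G q) $ i $ k * p$i * p$k))"

definition vert :: "'n::finite \<Rightarrow> (real^'n) \<times> (real^'n)" where
  "vert i = (0, axis i 1)"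

definition horiz ::
    "(real^'n \<Rightarrow> real^'n^'n) \<Rightarrow> (real^'n) \<times> (real^'n) \<Rightarrow> 'n \<Rightarrow> (real^'n) \<times> (real^'n)" where
  "horiz G z i = (axis i 1, \<chi> h. Gamma0 G z i h)"

definition J_horiz ::
    "(real \<Rightarrow> real) \<Rightarrow> (real \<Rightarrow> real) \<Rightarrow>
     (real^'n \<Rightarrow> real^'n^'n) \<Rightarrow> (real^'n) \<times> (real^'n) \<Rightarrow> 'n \<Rightarrow> (real^'n) \<times> (real^'n)" where
  "J_horiz a1 b1 G z i = (let (q, p) = z; t = energy G z in
     (\<Sum>j\<in>UNIV. (a1 t * G q $ i $ j + b1 t * p$i * p$j) *\<^sub>R vert j))"

definition J_vert ::
    "(real \<Rightarrow> real) \<Rightarrow> (real \<Rightarrow> real) \<Rightarrow>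
     (real^'n \<Rightarrow> real^'n^'n) \<Rightarrow> (real^'n) \<times> (real^'n) \<Rightarrow> 'n \<Rightarrow> (real^'n) \<times> (real^'n)" where
  "J_vert a2 b2 G z i = (let (q, p) = z; t = energy G z in
     (\<Sum>j\<in>UNIV. (- a2 t * matrix_inv (G q) $ i $ j - b2 t * g0 G z i * g0 G z j) *\<^sub>R horiz G z j))"

text \<open>The linear map with \<open>J \<delta>\<^sub>i = J_horiz i\<close> and \<open>J \<partial>\<^sup>i = J_vert i\<close>, using the expansion
  \<open>(u, w) = u\<^sup>i \<delta>\<^sub>i + (w\<^sub>h - u\<^sup>i \<Gamma>\<^sup>0\<^sub>i\<^sub>h) \<partial>\<^sup>h\<close> in the adapted frame.\<close>

definition J_chart ::
    "(real \<Rightarrow> real) \<Rightarrow> (real \<Rightarrow> real) \<Rightarrow> (real \<Rightarrow> real) \<Rightarrow> (real \<Rightarrow> real) \<Rightarrow>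
     (real^'n \<Rightarrow> real^'n^'n) \<Rightarrow> (real^'n) \<times> (real^'n) \<Rightarrow>
     (real^'n) \<times> (real^'n) \<Rightarrow> (real^'n) \<times> (real^'n)" where
  "J_chart a1 a2 b1 b2 G z = (\<lambda>(u, w).
     (\<Sum>i\<in>UNIV. (u$i) *\<^sub>R J_horiz a1 b1 G z i) +
     (\<Sum>h\<in>UNIV. (w$h - (\<Sum>i\<in>UNIV. u$i * Gamma0 G z i h)) *\<^sub>R J_vert a2 b2 G z h))"

lemma J_chart_vert: "J_chart a1 a2 b1 b2 G z (vert i) = J_vert a2 b2 G z i"
proof -
  have "(\<Sum>h\<in>UNIV. (axis i 1 $ h) *\<^sub>R J_vert a2 b2 G z h) =
        (\<Sum>h\<in>UNIV. if h = i then J_vert a2 b2 G z h else 0)"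
    by (intro sum.cong) (auto simp: axis_def)
  then show ?thesis
    by (simp add: J_chart_def vert_def)
qed

lemma J_chart_horiz: "J_chart a1 a2 b1 b2 G z (horiz G z i) = J_horiz a1 b1 G z i"
proof -
  have 1: "(\<Sum>h\<in>UNIV. (axis i 1 $ h) *\<^sub>R J_horiz a1 b1 G z h) =
        (\<Sum>h\<in>UNIV. if h = i then J_horiz a1 b1 G z h else 0)"
    by (intro sum.cong) (auto simp: axis_def)
  have "(\<Sum>k\<in>UNIV. axis i 1 $ k * Gamma0 G z k h) =
        (\<Sum>k\<in>UNIV. if k = i then Gamma0 G z k h else 0)" for h
    by (intro sum.cong) (auto simp: axis_def)
  with 1 show ?thesis
    by (simp add: J_chart_def horiz_def)
qed

definition natural_J ::
    "('i, 'm, real^'n) atlas \<Rightarrow> ('m \<Rightarrow> ('i \<Rightarrow> real^'n) \<Rightarrow> ('i \<Rightarrow> real^'n) \<Rightarrow> real) \<Rightarrow>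
     (real \<Rightarrow> real) \<Rightarrow> (real \<Rightarrow> real) \<Rightarrow> (real \<Rightarrow> real) \<Rightarrow> (real \<Rightarrow> real) \<Rightarrow>
     'm \<times> (('i \<Rightarrow> real^'n) \<Rightarrow> real) \<Rightarrow>
     ('i \<Rightarrow> (real^'n) \<times> (real^'n)) \<Rightarrow> ('i \<Rightarrow> (real^'n) \<times> (real^'n))" where
  "natural_J A g a1 a2 b1 b2 P v = (\<lambda>\<alpha>. if P \<in> chart_dom (cotangent_bundle A) \<alpha>
     then J_chart a1 a2 b1 b2 (metric_coeff A g \<alpha>) (chart_map (cotangent_bundle A) \<alpha> P) (v \<alpha>)
     else 0)"

end

theory Submission
  imports Defs
begin

text \<open>Integrability is tested chart by chart. As \<open>N\<close> is a tensor with \<open>N(JX,Y) = -J N(X,Y)\<close>, and the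
  horizontal distribution together with its image under \<open>J\<close> spans everything, it suffices to compute
  \<open>N\<close> on horizontal lifts \<open>\<delta>\<^sub>u\<close>. By metric compatibility, the mixed terms cancel, and
  \<open>N(\<delta>\<^sub>u, \<delta>\<^sub>v)\<close> is the vertical covector \<open>F(t) (p(u) g(v,\<cdot>) - p(v) g(u,\<cdot>)) - p(R(u,v)\<cdot>)\<close>
  with \<open>F = (a\<^sub>1 + 2tb\<^sub>1) a\<^sub>1' - a\<^sub>1b\<^sub>1\<close>.
  If it vanishes, rescaling \<open>p\<close> shows that \<open>F\<close> is a constant \<open>c\<close>, which is then the sectional curvature
  of \<open>M\<close> (Schur's lemma plays no role), and \<open>F = c\<close> is the formula
  for \<open>b\<^sub>1\<close>. Its denominator has no zeros because \<open>a\<^sub>1\<^sup>2 - 2ct\<close> solves a linear differential equation.\<close>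

section \<open>Calculus of smooth functions\<close>

text \<open>The mixed terms cancel because parallel transport preserves lengths: the energy
  \<open>t\<close> is constant along horizontal curves, so \<open>a1\<close> and \<open>b1\<close>
  contribute no derivative there, and the remaining terms cancel by compatibility and symmetry of
  the connection. The other two brackets survive: \<open>[J \<delta>_u, J \<delta>_v]\<close> yields
  the term with \<open>F\<close>, since \<open>t\<close> does vary vertically, and
  \<open>[\<delta>_u, \<delta>_v]\<close> yields the curvature term. The vanishing condition is
  imposed at every covector. Only when \<open>F\<close> is known to be constant are both sides
  linear in \<open>p\<close>, so that \<open>p\<close> can be removed and an identity for the
  curvature tensor remains. The equivalence of this identity with constant sectional curvature is
  pure algebra: a tensor with the symmetries of a curvature tensor is determined by its values on
  planes. The constant is read off from the multiples of one covector at one point, because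
  \<open>F\<close> depends on \<open>a1\<close>, \<open>b1\<close> and \<open>t\<close> alone; the
  same value then serves every chart.\<close>

lemma differentiable_on_open_has_derivative:
  assumes "open S" "f differentiable_on S" "x \<in> S"
  shows "(f has_derivative frechet_derivative f (at x)) (at x)"
  using assms by (simp add: differentiable_on_eq_differentiable_at flip: frechet_derivative_works)

lemma linear_euclidean_expansion:
  assumes "linear f"
  shows "f v = (\<Sum>b\<in>Basis. (v \<bullet> b) *\<^sub>R f b)"
  using linear_sum[OF assms, of "\<lambda>b. (v \<bullet> b) *\<^sub>R b" Basis] linear_cmul[OF assms]
  by (simp add: euclidean_representation)

lemma linear_axis_expansion:
  fixes f :: "real^'n \<Rightarrow> 'b::real_vector"
  assumes "linear f"
  shows "f x = (\<Sum>i\<in>UNIV. (x$i) *\<^sub>R f (axis i 1))"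
proof -
  have "f x = f (\<Sum>i\<in>UNIV. (x$i) *\<^sub>R axis i 1)"
    using basis_expansion[of x] by (simp add: scalar_mult_eq_scaleR)
  then show ?thesis
    by (simp add: linear_sum[OF assms] linear_cmul[OF assms])
qed

lemma inner_linear_expansion:
  fixes f :: "real^'n \<Rightarrow> 'b::real_inner"
  assumes "linear f"
  shows "p \<bullet> f w = (\<Sum>h\<in>UNIV. (p \<bullet> f (axis h 1)) * w $ h)"
  by (subst linear_axis_expansion[OF assms]) (simp add: inner_sum_right mult.commute)

lemma vec_lambda_axis_sum: "(\<chi> i. f i) = (\<Sum>i\<in>UNIV. f i *\<^sub>R axis i (1::real))"
  by (simp add: vec_eq_iff axis_def if_distrib cong: if_cong)

section \<open>Closure properties of k times continuously differentiable functions\<close>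

lemma Ck_on_cong:
  assumes "\<And>x. x \<in> S \<Longrightarrow> f x = g x" and "Ck_on k S f"
  shows "Ck_on k S g"
  using assms
proof (induction k arbitrary: f g)
  case 0
  then show ?case by (simp cong: continuous_on_cong)
next
  case (Suc k)
  have hd: "(f has_derivative D) (at x within S) \<longleftrightarrow> (g has_derivative D) (at x within S)"
    if "x \<in> S" for x D
    using Suc.prems(1) that by (metis has_derivative_transform)
  have "frechet_derivative f (at x within S) = frechet_derivative g (at x within S)" if "x \<in> S" for x
    unfolding frechet_derivative_def using hd[OF that] by simp
  note fd = this
  have "Ck_on k S (\<lambda>x. frechet_derivative g (at x within S) v)" for v
  proof (rule Suc.IH)
    show "Ck_on k S (\<lambda>x. frechet_derivative f (at x within S) v)"
      using Suc.prems(2) by simp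
  qed (simp add: fd)
  moreover have "g differentiable_on S"
    using Suc.prems(2) hd by (auto simp: differentiable_on_def differentiable_def)
  ultimately show ?case by simp
qed

lemma Ck_on_SucD: "Ck_on (Suc k) S f \<Longrightarrow> Ck_on k S f"
  by (induction k arbitrary: f) (auto simp: differentiable_imp_continuous_on)

text \<open>On an open set the derivative within the set is the full derivative, so any explicit
  formula for it may replace the chosen \<open>frechet_derivative\<close>. The closure properties
  below use this rule for their induction steps on \<open>k\<close>.\<close>

lemma Ck_on_SucI:
  assumes "open S" "\<And>x. x \<in> S \<Longrightarrow> (f has_derivative f' x) (at x)"
    and "\<And>v. Ck_on k S (\<lambda>x. f' x v)"
  shows "Ck_on (Suc k) S f"
proof -
  have "frechet_derivative f (at x within S) = f' x" if "x \<in> S" for x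
    using assms(1,2) that by (metis at_within_open frechet_derivative_at)
  then have "Ck_on k S (\<lambda>x. frechet_derivative f (at x within S) v)" for v
    by (intro Ck_on_cong[OF _ assms(3)[of v]]) simp
  moreover have "f differentiable_on S"
    using assms(1,2) by (auto simp: differentiable_on_eq_differentiable_at differentiable_def)
  ultimately show ?thesis by simp
qed

lemma Ck_on_Suc_derivative:
  assumes "open S" "Ck_on (Suc k) S f"
  shows "Ck_on k S (\<lambda>x. frechet_derivative f (at x) v)"
  by (rule Ck_on_cong[of S "\<lambda>x. frechet_derivative f (at x within S) v"])
     (use assms in \<open>simp_all add: at_within_open[of _ S]\<close>)

lemma Ck_on_Suc_has_derivative:
  assumes "open S" "Ck_on (Suc k) S f" "x \<in> S"
  shows "(f has_derivative frechet_derivative f (at x)) (at x)"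
  using assms differentiable_on_open_has_derivative by auto

lemma Ck_on_const: "open S \<Longrightarrow> Ck_on k S (\<lambda>x. c)"
  by (induction k arbitrary: c) (auto intro!: continuous_intros Ck_on_SucI[where f'="\<lambda>x v. 0"] derivative_eq_intros
      simp del: Ck_on.simps(2))

lemma Ck_on_bounded_linear:
  assumes "open S" "bounded_linear f"
  shows "Ck_on k S f"
proof (cases k)
  case 0
  then show ?thesis using assms by (simp add: linear_continuous_on)
next
  case (Suc l)
  show ?thesis unfolding Suc
    by (rule Ck_on_SucI[where f'="\<lambda>x. f"])
       (use assms in \<open>auto intro: bounded_linear_imp_has_derivative Ck_on_const\<close>)
qed

lemma Ck_on_add:
  assumes "open S" "Ck_on k S f" "Ck_on k S g"
  shows "Ck_on k S (\<lambda>x. f x + g x)"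
  using assms(2,3)
proof (induction k arbitrary: f g)
  case 0
  then show ?case by (auto intro: continuous_intros)
next
  case (Suc k)
  show ?case
    by (rule Ck_on_SucI[where f'="\<lambda>x v. frechet_derivative f (at x) v + frechet_derivative g (at x) v"])
       (use Suc assms(1) in \<open>auto simp del: Ck_on.simps intro!: has_derivative_add Suc.IH
          intro: Ck_on_Suc_derivative Ck_on_Suc_has_derivative\<close>)
qed

lemma Ck_on_sum:
  assumes "open S" "\<And>i. i \<in> I \<Longrightarrow> Ck_on k S (f i)"
  shows "Ck_on k S (\<lambda>x. \<Sum>i\<in>I. f i x)"
  using assms(2)
  by (induction I rule: infinite_finite_induct) (auto intro: Ck_on_const Ck_on_add assms(1))

lemma Ck_on_scaleR:
  fixes f :: "_ \<Rightarrow> real"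
  assumes "open S" "Ck_on k S f" "Ck_on k S g"
  shows "Ck_on k S (\<lambda>x. f x *\<^sub>R g x)"
  using assms(2,3)
proof (induction k arbitrary: f g)
  case 0
  then show ?case by (auto intro: continuous_intros)
next
  case (Suc k)
  note [simp del] = Ck_on.simps
  show ?case
  proof (rule Ck_on_SucI[where f'="\<lambda>x v. f x *\<^sub>R frechet_derivative g (at x) v + frechet_derivative f (at x) v *\<^sub>R g x"])
    show "((\<lambda>x. f x *\<^sub>R g x) has_derivative
       (\<lambda>v. f x *\<^sub>R frechet_derivative g (at x) v + frechet_derivative f (at x) v *\<^sub>R g x)) (at x)"
      if "x \<in> S" for x
      using Suc.prems that assms(1) by (intro has_derivative_scaleR Ck_on_Suc_has_derivative)
    show "Ck_on k S (\<lambda>x. f x *\<^sub>R frechet_derivative g (at x) v + frechet_derivative f (at x) v *\<^sub>R g x)" for v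
      using Suc.prems assms(1)
      by (intro Ck_on_add Suc.IH Ck_on_Suc_derivative) (auto dest: Ck_on_SucD)
  qed (use assms in auto)
qed

lemma Ck_on_linear_compose:
  assumes "open S" "bounded_linear h" "Ck_on k S f"
  shows "Ck_on k S (\<lambda>x. h (f x))"
  using assms(3)
proof (induction k arbitrary: f)
  case 0
  then show ?case using bounded_linear.continuous_on[OF assms(2)] by simp
next
  case (Suc k)
  note [simp del] = Ck_on.simps
  show ?case
    by (rule Ck_on_SucI[where f'="\<lambda>x v. h (frechet_derivative f (at x) v)"])
       (use Suc assms in \<open>auto intro!: bounded_linear.has_derivative[OF assms(2)] Suc.IH
          intro: Ck_on_Suc_derivative Ck_on_Suc_has_derivative\<close>)
qed

lemma Ck_on_compose:
  fixes f :: "'a::euclidean_space \<Rightarrow> 'b::euclidean_space" and g :: "'b \<Rightarrow> 'c::real_normed_vector"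
  assumes "open S" "open T" "f ` S \<subseteq> T" "Ck_on k S f" "Ck_on k T g"
  shows "Ck_on k S (\<lambda>x. g (f x))"
  using assms(4,5)
proof (induction k arbitrary: g)
  case 0
  then show ?case using assms(3) by (auto intro: continuous_on_compose2)
next
  case (Suc k)
  note [simp del] = Ck_on.simps
  have g: "(g has_derivative frechet_derivative g (at (f x))) (at (f x))" if "x \<in> S" for x
    using Suc.prems(2) assms(2,3) that by (auto intro: Ck_on_Suc_has_derivative)
  show ?case
  proof (rule Ck_on_SucI[where f'="\<lambda>x v. frechet_derivative g (at (f x)) (frechet_derivative f (at x) v)"])
    show "((\<lambda>x. g (f x)) has_derivative
        (\<lambda>v. frechet_derivative g (at (f x)) (frechet_derivative f (at x) v))) (at x)"
      if "x \<in> S" for x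
      using has_derivative_compose[OF Ck_on_Suc_has_derivative[OF assms(1) Suc.prems(1) that] g[OF that]] .
    fix v
    \<comment> \<open>The chain rule moves the direction together with the base point, whereas
      \<open>Ck_on\<close> only controls derivatives in fixed directions. Expanding in a basis turns
      the moving direction into scalar coefficients.\<close>
    have "Ck_on k S (\<lambda>x. \<Sum>b\<in>Basis. (frechet_derivative f (at x) v \<bullet> b) *\<^sub>R frechet_derivative g (at (f x)) b)"
    proof (intro Ck_on_sum Ck_on_scaleR assms(1))
      fix b :: 'b
      show "Ck_on k S (\<lambda>x. frechet_derivative f (at x) v \<bullet> b)"
        by (rule Ck_on_linear_compose[OF assms(1) bounded_linear_inner_left
              Ck_on_Suc_derivative[OF assms(1) Suc.prems(1)]])
      show "Ck_on k S (\<lambda>x. frechet_derivative g (at (f x)) b)"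
        by (rule Suc.IH) (use Suc.prems assms in \<open>auto intro: Ck_on_SucD Ck_on_Suc_derivative\<close>)
    qed
    note sum = this
    have expand: "frechet_derivative g (at (f x)) w = (\<Sum>b\<in>Basis. (w \<bullet> b) *\<^sub>R frechet_derivative g (at (f x)) b)"
      if "x \<in> S" for x w
      using g[OF that] by (intro linear_euclidean_expansion has_derivative_linear)
    show "Ck_on k S (\<lambda>x. frechet_derivative g (at (f x)) (frechet_derivative f (at x) v))"
      by (rule Ck_on_cong[OF _ sum]) (rule expand[symmetric])
  qed (use assms in auto)
qed

lemma smooth_onD_has_derivative:
  assumes "open S" "smooth_on S f" "x \<in> S"
  shows "(f has_derivative frechet_derivative f (at x)) (at x)"
  using assms Ck_on_Suc_has_derivative unfolding smooth_on_def by blast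

lemma smooth_on_derivative:
  assumes "open S" "smooth_on S f"
  shows "smooth_on S (\<lambda>x. frechet_derivative f (at x) v)"
  using assms Ck_on_Suc_derivative unfolding smooth_on_def by blast

lemma smooth_on_cong:
  assumes "\<And>x. x \<in> S \<Longrightarrow> f x = g x" and "smooth_on S f"
  shows "smooth_on S g"
  using assms Ck_on_cong unfolding smooth_on_def by blast

lemma smooth_on_bounded_linear: "open S \<Longrightarrow> bounded_linear f \<Longrightarrow> smooth_on S f"
  unfolding smooth_on_def using Ck_on_bounded_linear by blast

lemma smooth_on_const: "open S \<Longrightarrow> smooth_on S (\<lambda>x. c)"
  unfolding smooth_on_def using Ck_on_const by blast

lemma smooth_on_linear_compose:
  assumes "open S" "bounded_linear h" "smooth_on S f"
  shows "smooth_on S (\<lambda>x. h (f x))"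
  using assms Ck_on_linear_compose unfolding smooth_on_def by blast

lemma smooth_on_add:
  assumes "open S" "smooth_on S f" "smooth_on S g"
  shows "smooth_on S (\<lambda>x. f x + g x)"
  using assms Ck_on_add unfolding smooth_on_def by blast

lemma smooth_on_sum:
  assumes "open S" "\<And>i. i \<in> I \<Longrightarrow> smooth_on S (f i)"
  shows "smooth_on S (\<lambda>x. \<Sum>i\<in>I. f i x)"
  using assms Ck_on_sum[of S I _ f] unfolding smooth_on_def by blast

lemma smooth_on_scaleR:
  fixes f :: "_ \<Rightarrow> real"
  assumes "open S" "smooth_on S f" "smooth_on S g"
  shows "smooth_on S (\<lambda>x. f x *\<^sub>R g x)"
  using assms Ck_on_scaleR unfolding smooth_on_def by blast

lemma smooth_on_compose:
  fixes f :: "'a::euclidean_space \<Rightarrow> 'b::euclidean_space" and g :: "'b \<Rightarrow> 'c::real_normed_vector"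
  assumes "open S" "open T" "f ` S \<subseteq> T" "smooth_on S f" "smooth_on T g"
  shows "smooth_on S (\<lambda>x. g (f x))"
  using assms Ck_on_compose[OF assms(1-3)] unfolding smooth_on_def by blast

lemma smooth_on_Pair:
  assumes "open S" "smooth_on S f" "smooth_on S g"
  shows "smooth_on S (\<lambda>x. (f x, g x))"
proof -
  have "bounded_linear (\<lambda>y::'b. (y, 0::'c))" "bounded_linear (\<lambda>y::'c. (0::'b, y))"
    by (auto intro!: bounded_linear_Pair bounded_linear_zero bounded_linear_ident)
  from smooth_on_add[OF assms(1) smooth_on_linear_compose[OF assms(1) this(1) assms(2)]
      smooth_on_linear_compose[OF assms(1) this(2) assms(3)]]
  have "smooth_on S (\<lambda>x. (f x, 0::'c) + (0::'b, g x))" .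
  then show ?thesis by simp
qed

section \<open>Symmetry of second derivatives\<close>

lemma DERIV_along_line:
  fixes f :: "'a::real_normed_vector \<Rightarrow> real"
  assumes "(f has_derivative f') (at (a + s *\<^sub>R u))"
  shows "((\<lambda>s. f (a + s *\<^sub>R u)) has_real_derivative f' u) (at s)"
proof -
  have "((\<lambda>s. f (a + s *\<^sub>R u)) has_derivative (\<lambda>r. f' (r *\<^sub>R u))) (at s)"
    by (rule has_derivative_compose[where f="\<lambda>s. a + s *\<^sub>R u" and g=f, OF _ assms]) (auto intro!: derivative_eq_intros)
  moreover have "f' (r *\<^sub>R u) = f' u * r" for r
    using linear_cmul[OF has_derivative_linear[OF assms]] by (simp add: mult.commute)
  ultimately show ?thesis by (simp add: has_field_derivative_def)
qed

text \<open>Two applications of the mean value theorem: first along \<open>u\<close>, to the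
  difference between \<open>f\<close> shifted by \<open>h *\<^sub>R v\<close> and \<open>f\<close>
  itself, then along \<open>v\<close>, to the derivative obtained. The second difference on the left
  is symmetric in \<open>u\<close> and \<open>v\<close>, which is what it is used for.\<close>

lemma second_difference_mean_value:
  fixes f :: "'a::euclidean_space \<Rightarrow> real"
  assumes "ball x r \<subseteq> S" "open S"
    and f: "\<And>y. y \<in> S \<Longrightarrow> (f has_derivative D y) (at y)"
    and D: "\<And>y. y \<in> S \<Longrightarrow> ((\<lambda>y. D y u) has_derivative H y) (at y)"
    and h: "0 < h" "h * (norm u + norm v) < r"
  shows "\<exists>y\<in>ball x r. f (x + h *\<^sub>R u + h *\<^sub>R v) - f (x + h *\<^sub>R u) - f (x + h *\<^sub>R v) + f x = h * h * H y v"
proof -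
  have ball: "x + s *\<^sub>R u + t *\<^sub>R v \<in> ball x r" if "0 \<le> s" "s \<le> h" "0 \<le> t" "t \<le> h" for s t
  proof -
    have "norm (s *\<^sub>R u + t *\<^sub>R v) \<le> s * norm u + t * norm v"
      using norm_triangle_ineq[of "s *\<^sub>R u" "t *\<^sub>R v"] that by simp
    also have "\<dots> \<le> h * norm u + h * norm v"
      using that by (intro add_mono mult_right_mono) auto
    also have "\<dots> < r" using h by (simp add: algebra_simps)
    finally show ?thesis by (metis add.assoc add_diff_cancel_left' dist_commute dist_norm mem_ball)
  qed
  then have S: "x + s *\<^sub>R u + t *\<^sub>R v \<in> S" if "0 \<le> s" "s \<le> h" "0 \<le> t" "t \<le> h" for s t
    using assms(1) that by blast
  have "\<exists>z>0. z < h \<and> (f (x + h *\<^sub>R v + h *\<^sub>R u) - f (x + h *\<^sub>R u)) - (f (x + h *\<^sub>R v + 0 *\<^sub>R u) - f (x + 0 *\<^sub>R u))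
      = (h - 0) * (D (x + h *\<^sub>R v + z *\<^sub>R u) u - D (x + z *\<^sub>R u) u)"
  proof (rule MVT2[OF h(1)])
    fix s assume s: "0 \<le> s" "s \<le> h"
    have "x + h *\<^sub>R v + s *\<^sub>R u \<in> S" "x + s *\<^sub>R u \<in> S"
      using S[of s h] S[of s 0] s h(1) by (auto simp: algebra_simps)
    then show "((\<lambda>s. f (x + h *\<^sub>R v + s *\<^sub>R u) - f (x + s *\<^sub>R u)) has_real_derivative
       D (x + h *\<^sub>R v + s *\<^sub>R u) u - D (x + s *\<^sub>R u) u) (at s)"
      by (intro DERIV_diff DERIV_along_line f)
  qed
  then obtain z where z: "0 < z" "z < h"
    and 1: "(f (x + h *\<^sub>R v + h *\<^sub>R u) - f (x + h *\<^sub>R u)) - (f (x + h *\<^sub>R v) - f x)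
      = h * (D (x + h *\<^sub>R v + z *\<^sub>R u) u - D (x + z *\<^sub>R u) u)"
    by auto
  have "\<exists>w>0. w < h \<and> D (x + z *\<^sub>R u + h *\<^sub>R v) u - D (x + z *\<^sub>R u + 0 *\<^sub>R v) u
      = (h - 0) * H (x + z *\<^sub>R u + w *\<^sub>R v) v"
    by (rule MVT2[OF h(1)]) (use z S in \<open>intro DERIV_along_line D; simp\<close>)
  then obtain w where w: "0 < w" "w < h"
    and 2: "D (x + z *\<^sub>R u + h *\<^sub>R v) u - D (x + z *\<^sub>R u) u = h * H (x + z *\<^sub>R u + w *\<^sub>R v) v"
    by auto
  show ?thesis
    by (rule bexI[OF _ ball[of z w]]) (use 1 2 z w in \<open>auto simp: algebra_simps\<close>)
qed

text \<open>One and the same second difference equals \<open>h * h\<close> times either mixed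
  derivative, each taken at its own point near \<open>x\<close>. Continuity of both mixed
  derivatives brings these points back to \<open>x\<close>.\<close>

lemma second_derivative_symmetric:
  fixes f :: "'a::euclidean_space \<Rightarrow> real"
  assumes "open S" "smooth_on S f" "x \<in> S"
  shows "frechet_derivative (\<lambda>y. frechet_derivative f (at y) u) (at x) v
       = frechet_derivative (\<lambda>y. frechet_derivative f (at y) v) (at x) u"
proof -
  define H where "H u v = (\<lambda>x. frechet_derivative (\<lambda>y. frechet_derivative f (at y) u) (at x) v)" for u v
  have cont: "isCont (H u v) x" for u v
  proof -
    have "smooth_on S (H u v)"
      unfolding H_def by (intro smooth_on_derivative assms)
    then have "continuous_on S (H u v)"
      unfolding smooth_on_def using Ck_on.simps(1) by blast
    then show ?thesis using assms by (simp add: continuous_on_eq_continuous_at)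
  qed
  have "\<bar>H u v x - H v u x\<bar> \<le> e" if "e > 0" for e
  proof -
    obtain d1 where d1: "d1 > 0" "\<And>y. dist y x < d1 \<Longrightarrow> dist (H u v y) (H u v x) < e/2"
      using cont[of u v] \<open>e > 0\<close> unfolding continuous_at_eps_delta by (metis half_gt_zero)
    obtain d2 where d2: "d2 > 0" "\<And>y. dist y x < d2 \<Longrightarrow> dist (H v u y) (H v u x) < e/2"
      using cont[of v u] \<open>e > 0\<close> unfolding continuous_at_eps_delta by (metis half_gt_zero)
    obtain d3 where d3: "d3 > 0" "ball x d3 \<subseteq> S"
      using assms open_contains_ball by blast
    define r where "r = min d1 (min d2 d3)"
    \<comment> \<open>The summand 1 keeps the denominator positive when \<open>u\<close> and
      \<open>v\<close> both vanish.\<close>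
    define h where "h = r / (norm u + norm v + 1) / 2"
    have r: "r > 0" "ball x r \<subseteq> S" using d1 d2 d3 by (auto simp: r_def)
    have p: "norm u + norm v + 1 > 0" by (smt (verit) norm_ge_zero)
    then have h: "h > 0" using r by (simp add: h_def)
    have "h * (norm u + norm v) < 2 * h * (norm u + norm v + 1)"
      using h by (intro mult_strict_mono') (auto intro: add_nonneg_nonneg)
    also have "\<dots> = r" using p by (simp add: h_def field_simps)
    finally have hr: "h * (norm u + norm v) < r" .
    note 1 = smooth_onD_has_derivative[OF assms(1,2)]
      smooth_onD_has_derivative[OF assms(1) smooth_on_derivative[OF assms(1,2)]]
    obtain y where y: "y \<in> ball x r"
      "f (x + h *\<^sub>R u + h *\<^sub>R v) - f (x + h *\<^sub>R u) - f (x + h *\<^sub>R v) + f x = h * h * H u v y"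
      using second_difference_mean_value[OF r(2) assms(1) 1 h hr] unfolding H_def by blast
    have hr': "h * (norm v + norm u) < r" using hr by (simp add: add.commute)
    obtain z where z: "z \<in> ball x r"
      "f (x + h *\<^sub>R v + h *\<^sub>R u) - f (x + h *\<^sub>R v) - f (x + h *\<^sub>R u) + f x = h * h * H v u z"
      using second_difference_mean_value[OF r(2) assms(1) 1 h hr'] unfolding H_def by blast
    have "h * h * H u v y = h * h * H v u z"
      using y(2) z(2) by (simp add: algebra_simps)
    then have "H u v y = H v u z" using h by simp
    moreover have "dist (H u v y) (H u v x) < e/2" "dist (H v u z) (H v u x) < e/2"
      using y(1) z(1) by (intro d1(2) d2(2); simp add: r_def dist_commute)+
    ultimately show ?thesis unfolding dist_real_def by linarith
  qed
  then have "H u v x = H v u x"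
    using field_le_epsilon[of "\<bar>H u v x - H v u x\<bar>" 0] by simp
  then show ?thesis by (simp add: H_def)
qed

section \<open>One-sided derivatives on the half-line\<close>

lemma has_vector_derivative_ddt:
  assumes "f differentiable_on {0..}" "t \<ge> 0"
  shows "(f has_vector_derivative ddt f t) (at t within {0..})"
  using assms by (simp add: ddt_def differentiable_onD vector_derivative_works[symmetric])

lemma smooth_on_halfline_differentiable:
  fixes f :: "real \<Rightarrow> real"
  assumes "smooth_on {0..} f"
  shows "f differentiable_on {0..}"
  using assms Ck_on.simps(2) unfolding smooth_on_def by blast

text \<open>Smoothness is stated with Frechet derivatives and \<open>ddt\<close> with vector
  derivatives; both agree because derivatives within \<open>{0..}\<close> are unique. Continuity up
  to 0 is what later carries the constancy of \<open>F\<close> from positive \<open>t\<close> to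
  \<open>t = 0\<close>.\<close>

lemma continuous_on_ddt:
  assumes "smooth_on {0..} f"
  shows "continuous_on {0..} (ddt f)"
proof -
  have "Ck_on (Suc 0) {0..} f" using assms unfolding smooth_on_def by blast
  then have f: "f differentiable_on {0..}"
    and D: "continuous_on {0..} (\<lambda>t. frechet_derivative f (at t within {0..}) 1)" by auto
  have "ddt f t = frechet_derivative f (at t within {0..}) 1" if "t \<in> {0..}" for t
  proof -
    \<comment> \<open>Right-hand neighbourhoods are enough for uniqueness, so the boundary point 0
      needs no separate treatment.\<close>
    have "at_right t \<le> at t within {0..}" using that by (intro at_le) auto
    then have nt: "at t within {0..} \<noteq> bot" using trivial_limit_at_right_real[of t] by (auto simp: bot_unique)
    let ?D = "frechet_derivative f (at t within {0..})"
    have d: "(f has_derivative ?D) (at t within {0..})"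
      using f that by (simp add: differentiable_on_def flip: frechet_derivative_works)
    have "?D h = h *\<^sub>R ?D 1" for h
      using linear_cmul[OF has_derivative_linear[OF d], of h 1] by simp
    then have "(f has_vector_derivative ?D 1) (at t within {0..})"
      unfolding has_vector_derivative_def by (intro has_derivative_eq_rhs[OF d] ext)
    then show ?thesis unfolding ddt_def by (rule vector_derivative_within[OF nt])
  qed
  then show ?thesis by (intro continuous_on_eq[OF D]) simp
qed

text \<open>Both functions have the same derivative predicate at \<open>z\<close>, so the choice
  behind \<open>frechet_derivative\<close> returns the same map even where no derivative exists.
  Brackets of arbitrary fields can thus be rewritten on a chart image.\<close>

lemma frechet_derivative_cong_open:
  assumes "open S" "z \<in> S" "\<And>y. y \<in> S \<Longrightarrow> f y = g y"
  shows "frechet_derivative f (at z) = frechet_derivative g (at z)"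
proof -
  have "(f has_derivative D) (at z) \<longleftrightarrow> (g has_derivative D) (at z)" for D
    using has_derivative_transform_within_open[of f D z UNIV S g]
      has_derivative_transform_within_open[of g D z UNIV S f] assms by auto
  then show ?thesis by (simp add: frechet_derivative_def)
qed

text \<open>With \<open>k = a + 2tb\<close> and \<open>w = a\<^sup>2 - 2ct\<close>, the hypothesis gives \<open>k (a - 2ta') = w\<close> and the linear equation
  \<open>w' = (2b/k) w\<close>; since \<open>w(0) > 0\<close>, \<open>w\<close> has no zeros.\<close>

lemma denominator_nonzero:
  fixes a b :: "real \<Rightarrow> real"
  assumes a: "a differentiable_on {0..}" and b: "continuous_on {0..} b"
    and pos: "\<And>t. t \<ge> 0 \<Longrightarrow> a t > 0" "\<And>t. t \<ge> 0 \<Longrightarrow> a t + 2 * t * b t > 0"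
    and eq: "\<And>t. t \<ge> 0 \<Longrightarrow> (a t + 2 * t * b t) * ddt a t - a t * b t = c"
    and T: "T \<ge> 0"
  shows "a T - 2 * T * ddt a T \<noteq> 0"
proof -
  define k where "k t = a t + 2 * t * b t" for t
  define w where "w t = (a t)\<^sup>2 - 2 * c * t" for t
  have kpos: "k t > 0" if "t \<ge> 0" for t using pos(2)[OF that] by (simp add: k_def)
  have "continuous_on {0..} (\<lambda>t. 2 * b t / k t)"
    unfolding k_def using pos(2) less_irrefl
    by (intro continuous_intros b differentiable_imp_continuous_on[OF a]) fastforce
  then have "continuous_on {0..T} (\<lambda>t. 2 * b t / k t)"
    by (rule continuous_on_subset) auto
  \<comment> \<open>A primitive of the coefficient \<open>2b/k\<close>; \<open>exp (- m)\<close> is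
    the integrating factor that makes \<open>w * exp (- m)\<close> constant.\<close>
  then obtain m where m: "\<And>t. t \<in> {0..T} \<Longrightarrow> (m has_vector_derivative 2 * b t / k t) (at t within {0..T})"
    using antiderivative_continuous by blast
  have "((\<lambda>t. w t * exp (- m t)) has_field_derivative 0) (at t within {0..T})" if t: "t \<in> {0..T}" for t
  proof -
    have da: "(a has_field_derivative ddt a t) (at t within {0..T})"
      using has_vector_derivative_ddt[OF a, of t] t
      by (auto simp: has_real_derivative_iff_has_vector_derivative intro: has_vector_derivative_within_subset)
    have dm: "(m has_field_derivative 2 * b t / k t) (at t within {0..T})"
      using m[OF t] by (simp add: has_real_derivative_iff_has_vector_derivative)
    have "k t * (2 * a t * ddt a t - 2 * c) = 2 * b t * w t"
    proof -
      have c: "c = k t * ddt a t - a t * b t" using eq[of t] t by (simp add: k_def)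
      have tb: "2 * t * b t = k t - a t" by (simp add: k_def)
      have "2 * b t * w t = 2 * b t * (a t)\<^sup>2 - 2 * (2 * t * b t) * c" by (simp add: w_def algebra_simps)
      also have "\<dots> = k t * (2 * a t * ddt a t - 2 * c)"
        unfolding tb by (subst (1 2) c) (simp add: power2_eq_square algebra_simps)
      finally show ?thesis by simp
    qed
    then have w': "2 * a t * ddt a t - 2 * c = w t * (2 * b t / k t)"
      using kpos[of t] t by (simp add: field_simps)
    have dw: "(w has_field_derivative 2 * a t * ddt a t - 2 * c) (at t within {0..T})"
      unfolding w_def by (auto intro!: derivative_eq_intros da)
    have "((\<lambda>t. w t * exp (- m t)) has_field_derivative
        (2 * a t * ddt a t - 2 * c) * exp (- m t) + exp (- m t) * (- (2 * b t / k t)) * w t) (at t within {0..T})"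
      by (auto intro!: derivative_eq_intros dw dm)
    then show ?thesis unfolding w' by (simp add: algebra_simps)
  qed
  then have "\<exists>C. \<forall>t\<in>{0..T}. w t * exp (- m t) = C"
    by (intro has_field_derivative_zero_constant convex_real_interval)
  then obtain C where C: "\<And>t. t \<in> {0..T} \<Longrightarrow> w t * exp (- m t) = C" by blast
  have "w 0 * exp (- m 0) > 0" using pos(1)[of 0] by (simp add: w_def)
  then have "w T * exp (- m T) > 0" using C[of 0] C[of T] T by simp
  then have "w T \<noteq> 0" by auto
  moreover have "k T * (a T - 2 * T * ddt a T) = w T"
    unfolding w_def eq[OF T, symmetric] k_def by (simp add: power2_eq_square algebra_simps)
  ultimately show ?thesis by auto
qed

section \<open>Atlases and the cotangent bundle\<close>

text \<open>The coordinate conditions on an atlas, separated out so that they can be instantiated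
  for the base and for its cotangent bundle alike.\<close>

locale smooth_atlas =
  fixes A :: "('i, 'p, 'e::euclidean_space) atlas"
  assumes inj: "inj_on (chart_map A \<alpha>) (chart_dom A \<alpha>)"
    and open_overlap: "open (chart_map A \<alpha> ` (chart_dom A \<alpha> \<inter> chart_dom A \<beta>))"
    and smooth_transition: "smooth_on (chart_map A \<alpha> ` (chart_dom A \<alpha> \<inter> chart_dom A \<beta>)) (transition A \<alpha> \<beta>)"
begin

lemma chart_inv_map [simp]: "p \<in> chart_dom A \<alpha> \<Longrightarrow> chart_inv A \<alpha> (chart_map A \<alpha> p) = p"
  by (simp add: chart_inv_def inj)

lemma transition_map [simp]: "p \<in> chart_dom A \<alpha> \<Longrightarrow> transition A \<alpha> \<beta> (chart_map A \<alpha> p) = chart_map A \<beta> p"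
  by (simp add: transition_def)

lemma image_chart_Int:
  "chart_map A \<alpha> ` (S \<inter> T \<inter> chart_dom A \<alpha>)
    = chart_map A \<alpha> ` (S \<inter> chart_dom A \<alpha>) \<inter> chart_map A \<alpha> ` (T \<inter> chart_dom A \<alpha>)"
  using inj_on_image_Int[OF inj[of \<alpha>], of "S \<inter> chart_dom A \<alpha>" "T \<inter> chart_dom A \<alpha>"]
  by (simp add: Int_ac)

lemma open_chart_img: "open (chart_img A \<alpha>)"
  using open_overlap[of \<alpha> \<alpha>] by (simp add: chart_img_def)

lemma transition_has_derivative:
  assumes "p \<in> chart_dom A \<alpha>" "p \<in> chart_dom A \<beta>"
  shows "(transition A \<alpha> \<beta> has_derivative frechet_derivative (transition A \<alpha> \<beta>) (at (chart_map A \<alpha> p)))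
    (at (chart_map A \<alpha> p))"
  using assms by (intro smooth_onD_has_derivative[OF open_overlap smooth_transition]) auto

lemma transition_derivative_self:
  assumes "p \<in> chart_dom A \<alpha>"
  shows "frechet_derivative (transition A \<alpha> \<alpha>) (at (chart_map A \<alpha> p)) e = e"
proof -
  have "((\<lambda>z. z) has_derivative (\<lambda>e. e)) (at (chart_map A \<alpha> p))" by simp
  then have "(transition A \<alpha> \<alpha> has_derivative (\<lambda>e. e)) (at (chart_map A \<alpha> p))"
    by (rule has_derivative_transform_within_open[OF _ open_chart_img[of \<alpha>]])
       (use assms in \<open>auto simp: chart_img_def\<close>)
  then show ?thesis by (metis frechet_derivative_at)
qed

lemma transition_derivative_chain:
  assumes "p \<in> chart_dom A \<alpha>" "p \<in> chart_dom A \<beta>" "p \<in> chart_dom A \<gamma>"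
  shows "frechet_derivative (transition A \<beta> \<gamma>) (at (chart_map A \<beta> p))
      (frechet_derivative (transition A \<alpha> \<beta>) (at (chart_map A \<alpha> p)) e)
    = frechet_derivative (transition A \<alpha> \<gamma>) (at (chart_map A \<alpha> p)) e"
proof -
  let ?O = "chart_map A \<alpha> ` (chart_dom A \<beta> \<inter> chart_dom A \<gamma> \<inter> chart_dom A \<alpha>)"
  have O: "open ?O"
    unfolding image_chart_Int using open_overlap by (auto simp: Int_commute intro!: open_Int)
  have "((\<lambda>z. transition A \<beta> \<gamma> (transition A \<alpha> \<beta> z)) has_derivative
      (\<lambda>e. frechet_derivative (transition A \<beta> \<gamma>) (at (chart_map A \<beta> p))
         (frechet_derivative (transition A \<alpha> \<beta>) (at (chart_map A \<alpha> p)) e))) (at (chart_map A \<alpha> p))"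
    using has_derivative_compose[OF transition_has_derivative[OF assms(1,2)], of "transition A \<beta> \<gamma>"]
      transition_has_derivative[OF assms(2,3)] assms by simp
  then have "(transition A \<alpha> \<gamma> has_derivative
      (\<lambda>e. frechet_derivative (transition A \<beta> \<gamma>) (at (chart_map A \<beta> p))
         (frechet_derivative (transition A \<alpha> \<beta>) (at (chart_map A \<alpha> p)) e))) (at (chart_map A \<alpha> p))"
    by (rule has_derivative_transform_within_open[OF _ O]) (use assms in auto)
  then show ?thesis by (metis frechet_derivative_at)
qed

lemma coord_vector_same: "p \<in> chart_dom A \<alpha> \<Longrightarrow> coord_vector A \<alpha> p e \<alpha> = e"
  by (simp add: coord_vector_def transition_derivative_self)

lemma coord_vector_in_tangent_space:
  "p \<in> chart_dom A \<alpha> \<Longrightarrow> coord_vector A \<alpha> p e \<in> tangent_space A p"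
  by (auto simp: tangent_space_def coord_vector_def transition_derivative_chain)

lemma coord_vector_tangent:
  assumes "p \<in> chart_dom A \<alpha>" "v \<in> tangent_space A p"
  shows "coord_vector A \<alpha> p (v \<alpha>) = v"
proof
  fix \<beta>
  have "p \<in> chart_dom A \<beta> \<Longrightarrow> v \<beta> = frechet_derivative (transition A \<alpha> \<beta>) (at (chart_map A \<alpha> p)) (v \<alpha>)"
    and "p \<notin> chart_dom A \<beta> \<Longrightarrow> v \<beta> = 0"
    using assms unfolding tangent_space_def by blast+
  then show "coord_vector A \<alpha> p (v \<alpha>) \<beta> = v \<beta>"
    by (simp add: coord_vector_def)
qed

lemma coord_vector_linear:
  assumes "p \<in> chart_dom A \<alpha>"
  shows "coord_vector A \<alpha> p (r *\<^sub>R e + e') = (\<lambda>\<beta>. r *\<^sub>R coord_vector A \<alpha> p e \<beta> + coord_vector A \<alpha> p e' \<beta>)"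
  using has_derivative_linear[OF transition_has_derivative[OF assms]]
  by (auto simp: coord_vector_def linear_add linear_cmul)

lemma tangent_space_combination:
  assumes "p \<in> chart_dom A \<alpha>" "v \<in> tangent_space A p" "w \<in> tangent_space A p"
  shows "(\<lambda>\<beta>. r *\<^sub>R v \<beta> + w \<beta>) \<in> tangent_space A p"
  using coord_vector_in_tangent_space[OF assms(1), of "r *\<^sub>R v \<alpha> + w \<alpha>"]
  by (simp add: coord_vector_linear[OF assms(1)] coord_vector_tangent[OF assms(1)] assms(2,3))

lemma linear_form_coord_vector:
  assumes "p \<in> chart_dom A \<alpha>" "linear_form_on (tangent_space A p) f"
  shows "linear (\<lambda>e. f (coord_vector A \<alpha> p e))"
proof -
  have *: "f (coord_vector A \<alpha> p (r *\<^sub>R e + e')) = r * f (coord_vector A \<alpha> p e) + f (coord_vector A \<alpha> p e')"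
    for r e e'
    using assms by (simp add: coord_vector_linear linear_form_on_def coord_vector_in_tangent_space)
  show ?thesis
    \<comment> \<open>Additivity is the case \<open>r = 1\<close>. Homogeneity is the case
      \<open>e' = 0\<close>, once \<open>r = 1\<close>, \<open>e = e' = 0\<close> has shown that the
      zero vector goes to 0.\<close>
    by (rule linearI) (use *[of 1] *[of _ _ 0] *[of 1 0 0] in auto)
qed

text \<open>The function \<open>topology\<close> returns its predicate only if that predicate
  satisfies the axioms; stability under intersections rests on injectivity of the charts.\<close>

lemma openin_atlas_topology:
  "openin (atlas_topology A) W \<longleftrightarrow> W \<subseteq> points A \<and> (\<forall>\<alpha>. open (chart_map A \<alpha> ` (W \<inter> chart_dom A \<alpha>)))"
proof -
  have "istopology (\<lambda>W. W \<subseteq> points A \<and> (\<forall>\<alpha>. open (chart_map A \<alpha> ` (W \<inter> chart_dom A \<alpha>))))"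
    unfolding istopology_def
  proof (intro conjI allI impI)
    fix K \<alpha>
    assume "\<forall>S\<in>K. S \<subseteq> points A \<and> (\<forall>\<alpha>. open (chart_map A \<alpha> ` (S \<inter> chart_dom A \<alpha>)))"
    moreover have "chart_map A \<alpha> ` (\<Union>K \<inter> chart_dom A \<alpha>) = (\<Union>S\<in>K. chart_map A \<alpha> ` (S \<inter> chart_dom A \<alpha>))"
      by auto
    ultimately show "open (chart_map A \<alpha> ` (\<Union>K \<inter> chart_dom A \<alpha>))" by auto
  qed (auto simp: image_chart_Int)
  then show ?thesis
    by (simp add: atlas_topology_def topology_inverse')
qed

lemma openin_chart_dom: "openin (atlas_topology A) (chart_dom A \<alpha>)"
  using open_overlap by (auto simp: openin_atlas_topology points_def Int_commute)

text \<open>These are the test fields for integrability: they attain every tangent vector. In a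
  second chart \<beta> their components are the Jacobian of the change from \<alpha> to \<beta>,
  evaluated at the \<alpha>-coordinates of the point and applied to \<open>e\<close>, hence
  smooth.\<close>

lemma vector_field_on_coord_vector:
  "vector_field_on A (chart_dom A \<alpha>) (\<lambda>p. coord_vector A \<alpha> p e)"
  unfolding vector_field_on_def
proof (intro conjI ballI allI)
  fix \<beta>
  let ?O = "\<lambda>\<alpha> \<beta>. chart_map A \<alpha> ` (chart_dom A \<alpha> \<inter> chart_dom A \<beta>)"
  have "smooth_on (?O \<beta> \<alpha>) (\<lambda>z. frechet_derivative (transition A \<alpha> \<beta>) (at (transition A \<beta> \<alpha> z)) e)"
    by (rule smooth_on_compose[where f="transition A \<beta> \<alpha>" and T="?O \<alpha> \<beta>"])
       (auto intro!: open_overlap smooth_transition smooth_on_derivative)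
  then have "smooth_on (?O \<beta> \<alpha>) (\<lambda>z. coord_vector A \<alpha> (chart_inv A \<beta> z) e \<beta>)"
    by (rule smooth_on_cong[rotated]) (auto simp: coord_vector_def)
  then show "smooth_on (chart_map A \<beta> ` (chart_dom A \<alpha> \<inter> chart_dom A \<beta>))
      (\<lambda>z. coord_vector A \<alpha> (chart_inv A \<beta> z) e \<beta>)"
    by (simp add: Int_commute)
qed (rule coord_vector_in_tangent_space)

end

lemma smooth_manifold_imp_smooth_atlas: "smooth_manifold A \<Longrightarrow> smooth_atlas A"
  by unfold_locales (auto simp: smooth_manifold_def)

section \<open>Induced charts of the cotangent bundle\<close>

locale smooth_atlas_vec = smooth_atlas A for A :: "('i, 'm, real^'n) atlas"
begin

lemma covector_expansion:
  assumes "m \<in> chart_dom A \<alpha>" "\<xi> \<in> cotangent_space A m" "v \<in> tangent_space A m"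
  shows "\<xi> v = (\<Sum>i\<in>UNIV. v \<alpha> $ i * \<xi> (coord_vector A \<alpha> m (axis i 1)))"
  using linear_axis_expansion[OF linear_form_coord_vector[OF assms(1)], of \<xi> "v \<alpha>"]
    coord_vector_tangent[OF assms(1,3)] assms(2) by (simp add: cotangent_space_def)

lemma covector_of_components:
  fixes p :: "real^'n"
  assumes "m \<in> chart_dom A \<alpha>"
  obtains \<xi> where "\<xi> \<in> cotangent_space A m" "(\<chi> i. \<xi> (coord_vector A \<alpha> m (axis i 1))) = p"
proof
  let ?\<xi> = "\<lambda>v. if v \<in> tangent_space A m then p \<bullet> v \<alpha> else 0"
  show "?\<xi> \<in> cotangent_space A m"
    by (auto simp: cotangent_space_def linear_form_on_def tangent_space_combination[OF assms] inner_right_distrib)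
  show "(\<chi> i. ?\<xi> (coord_vector A \<alpha> m (axis i 1))) = p"
    by (simp add: coord_vector_in_tangent_space[OF assms] coord_vector_same[OF assms] vec_eq_iff inner_axis)
qed

lemma cotangent_chart_dom: "chart_dom (cotangent_bundle A) \<alpha> = {(m, \<xi>). m \<in> chart_dom A \<alpha> \<and> \<xi> \<in> cotangent_space A m}"
  by (simp add: cotangent_bundle_def)

lemma cotangent_chart_map: "chart_map (cotangent_bundle A) \<alpha> (m, \<xi>) = (chart_map A \<alpha> m, \<chi> i. \<xi> (coord_vector A \<alpha> m (axis i 1)))"
  by (simp add: cotangent_bundle_def)

text \<open>The fibre coordinate is unrestricted because every component vector comes from a
  covector. This is what makes the images of the induced charts open.\<close>

lemma cotangent_overlap:
  "chart_map (cotangent_bundle A) \<alpha> ` (chart_dom (cotangent_bundle A) \<alpha> \<inter> chart_dom (cotangent_bundle A) \<beta>)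
    = chart_map A \<alpha> ` (chart_dom A \<alpha> \<inter> chart_dom A \<beta>) \<times> UNIV" (is "?L = ?R")
proof
  show "?L \<subseteq> ?R" by (auto simp: cotangent_chart_dom cotangent_chart_map)
  show "?R \<subseteq> ?L"
  proof
    fix z assume "z \<in> ?R"
    then obtain m p where z: "z = (chart_map A \<alpha> m, p)" "m \<in> chart_dom A \<alpha>" "m \<in> chart_dom A \<beta>" by auto
    obtain \<xi> where "\<xi> \<in> cotangent_space A m" "(\<chi> i. \<xi> (coord_vector A \<alpha> m (axis i 1))) = p"
      using covector_of_components[OF z(2)] .
    then have "z = chart_map (cotangent_bundle A) \<alpha> (m, \<xi>)"
      "(m, \<xi>) \<in> chart_dom (cotangent_bundle A) \<alpha> \<inter> chart_dom (cotangent_bundle A) \<beta>"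
      using z by (auto simp: cotangent_chart_dom cotangent_chart_map)
    then show "z \<in> ?L" by (rule image_eqI)
  qed
qed

lemma inj_cotangent_chart: "inj_on (chart_map (cotangent_bundle A) \<alpha>) (chart_dom (cotangent_bundle A) \<alpha>)"
proof (rule inj_onI)
  fix P P' assume P: "P \<in> chart_dom (cotangent_bundle A) \<alpha>" "P' \<in> chart_dom (cotangent_bundle A) \<alpha>"
    and eq: "chart_map (cotangent_bundle A) \<alpha> P = chart_map (cotangent_bundle A) \<alpha> P'"
  obtain m \<xi> m' \<xi>' where mm: "P = (m, \<xi>)" "P' = (m', \<xi>')" by (cases P, cases P')
  have dom: "m \<in> chart_dom A \<alpha>" "\<xi> \<in> cotangent_space A m" "m' \<in> chart_dom A \<alpha>" "\<xi>' \<in> cotangent_space A m'"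
    using P by (auto simp: mm cotangent_chart_dom)
  have "m = m'" using eq dom inj by (auto simp: mm cotangent_chart_map dest: inj_onD)
  moreover have "\<xi> v = \<xi>' v" for v
  proof (cases "v \<in> tangent_space A m")
    case True
    have "\<xi> (coord_vector A \<alpha> m (axis i 1)) = \<xi>' (coord_vector A \<alpha> m (axis i 1))" for i
      using eq \<open>m = m'\<close> by (auto simp: mm cotangent_chart_map vec_eq_iff)
    then show ?thesis
      using covector_expansion[OF dom(1,2) True] covector_expansion[OF dom(1) _ True, of \<xi>'] dom \<open>m = m'\<close> by simp
  next
    case False
    then show ?thesis using dom \<open>m = m'\<close> by (auto simp: cotangent_space_def)
  qed
  ultimately show "P = P'" by (auto simp: mm)
qed

text \<open>The components of a covector transform with the transposed inverse of the Jacobian matrix,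
  which is the Jacobian matrix of the inverse coordinate change.\<close>

lemma cotangent_transition:
  assumes "q \<in> chart_map A \<alpha> ` (chart_dom A \<alpha> \<inter> chart_dom A \<beta>)"
  shows "transition (cotangent_bundle A) \<alpha> \<beta> (q, p) = (transition A \<alpha> \<beta> q,
    \<Sum>j\<in>UNIV. (\<Sum>i\<in>UNIV. (frechet_derivative (transition A \<beta> \<alpha>) (at (transition A \<alpha> \<beta> q)) (axis j 1) $ i) *\<^sub>R p $ i) *\<^sub>R axis j 1)"
proof -
  have "(q, p) \<in> chart_map (cotangent_bundle A) \<alpha> ` (chart_dom (cotangent_bundle A) \<alpha> \<inter> chart_dom (cotangent_bundle A) \<beta>)"
    unfolding cotangent_overlap using assms by simp
  then obtain P where P: "(q, p) = chart_map (cotangent_bundle A) \<alpha> P" 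
    "P \<in> chart_dom (cotangent_bundle A) \<alpha>" "P \<in> chart_dom (cotangent_bundle A) \<beta>" by auto
  obtain m \<xi> where m: "P = (m, \<xi>)" by (cases P)
  have dom: "m \<in> chart_dom A \<alpha>" "m \<in> chart_dom A \<beta>" "\<xi> \<in> cotangent_space A m"
    using P by (auto simp: m cotangent_chart_dom)
  have q: "q = chart_map A \<alpha> m" and p: "p = (\<chi> i. \<xi> (coord_vector A \<alpha> m (axis i 1)))"
    using P(1) by (auto simp: m cotangent_chart_map)
  have "transition (cotangent_bundle A) \<alpha> \<beta> (q, p) = chart_map (cotangent_bundle A) \<beta> P"
    unfolding P(1) using P(2) inj_cotangent_chart by (simp add: transition_def chart_inv_def)
  also have "\<dots> = (chart_map A \<beta> m, \<chi> j. \<xi> (coord_vector A \<beta> m (axis j 1)))"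
    by (simp add: m cotangent_chart_map)
  moreover have "\<xi> (coord_vector A \<beta> m (axis j 1)) = (\<Sum>i\<in>UNIV. coord_vector A \<beta> m (axis j 1) \<alpha> $ i * p $ i)" for j
    by (subst covector_expansion[OF dom(1,3) coord_vector_in_tangent_space[OF dom(2)]]) (simp add: p)
  ultimately show ?thesis
    using dom by (simp add: vec_lambda_axis_sum q coord_vector_def)
qed

lemma smooth_atlas_cotangent_bundle: "smooth_atlas (cotangent_bundle A)"
proof
  fix \<alpha> \<beta>
  let ?O = "\<lambda>\<alpha> \<beta>. chart_map A \<alpha> ` (chart_dom A \<alpha> \<inter> chart_dom A \<beta>)"
  have O: "open (?O \<alpha> \<beta> \<times> (UNIV :: (real^'n) set))"
    by (intro open_Times open_overlap open_UNIV)
  then show "open (chart_map (cotangent_bundle A) \<alpha> ` (chart_dom (cotangent_bundle A) \<alpha> \<inter> chart_dom (cotangent_bundle A) \<beta>))"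
    unfolding cotangent_overlap .
  have q: "smooth_on (?O \<alpha> \<beta> \<times> (UNIV :: (real^'n) set)) (\<lambda>z. transition A \<alpha> \<beta> (fst z))"
    by (rule smooth_on_compose[OF O open_overlap _ smooth_on_bounded_linear[OF O bounded_linear_fst] smooth_transition]) auto
  have D: "smooth_on (?O \<alpha> \<beta> \<times> (UNIV :: (real^'n) set))
     (\<lambda>z. frechet_derivative (transition A \<beta> \<alpha>) (at (transition A \<alpha> \<beta> (fst z))) e)" for e
    by (rule smooth_on_compose[OF O open_overlap[of \<beta> \<alpha>] _ q smooth_on_derivative[OF open_overlap smooth_transition]]) auto
  have "smooth_on (?O \<alpha> \<beta> \<times> (UNIV :: (real^'n) set)) (\<lambda>z. (transition A \<alpha> \<beta> (fst z),
    \<Sum>j\<in>UNIV. (\<Sum>i\<in>UNIV. (frechet_derivative (transition A \<beta> \<alpha>) (at (transition A \<alpha> \<beta> (fst z))) (axis j 1) $ i) *\<^sub>R snd z $ i) *\<^sub>R axis j 1))"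
    by (intro smooth_on_Pair[OF O q] smooth_on_sum[OF O] smooth_on_scaleR[OF O] smooth_on_const[OF O]
        smooth_on_linear_compose[OF O bounded_linear_vec_nth D]
        smooth_on_bounded_linear[OF O bounded_linear_compose[OF bounded_linear_vec_nth bounded_linear_snd]])
  then show "smooth_on (chart_map (cotangent_bundle A) \<alpha> ` (chart_dom (cotangent_bundle A) \<alpha> \<inter> chart_dom (cotangent_bundle A) \<beta>))
      (transition (cotangent_bundle A) \<alpha> \<beta>)"
    unfolding cotangent_overlap by (rule smooth_on_cong[rotated]) (auto simp: cotangent_transition)
qed (rule inj_cotangent_chart)

end

section \<open>The Nijenhuis tensor in a chart\<close>

definition bracket :: "('e::euclidean_space \<Rightarrow> 'e) \<Rightarrow> ('e \<Rightarrow> 'e) \<Rightarrow> 'e \<Rightarrow> 'e" where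
  "bracket X Y z = frechet_derivative Y (at z) (X z) - frechet_derivative X (at z) (Y z)"

locale almost_complex =
  fixes S :: "'e::euclidean_space set" and J :: "'e \<Rightarrow> 'e \<Rightarrow> 'e"
  assumes open_S: "open S"
    and linear_J: "z \<in> S \<Longrightarrow> linear (J z)"
    and differentiable_J: "z \<in> S \<Longrightarrow> (\<lambda>y. J y e) differentiable (at z)"
    and J_J: "z \<in> S \<Longrightarrow> J z (J z e) = - e"
begin

definition dJ :: "'e \<Rightarrow> 'e \<Rightarrow> 'e \<Rightarrow> 'e" where
  "dJ z x e = frechet_derivative (\<lambda>y. J y e) (at z) x"

text \<open>The Nijenhuis tensor on the constant fields \<open>e\<close> and \<open>f\<close>, for
  which \<open>[e, f] = 0\<close>. It contains only first derivatives of \<open>J\<close>.\<close>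

definition torsion :: "'e \<Rightarrow> 'e \<Rightarrow> 'e \<Rightarrow> 'e" where
  "torsion z e f = dJ z (J z e) f - dJ z (J z f) e + J z (dJ z f e) - J z (dJ z e f)"

lemma has_derivative_J: "z \<in> S \<Longrightarrow> ((\<lambda>y. J y e) has_derivative (\<lambda>x. dJ z x e)) (at z)"
  using differentiable_J[of z e] by (simp add: dJ_def frechet_derivative_works)

lemma linear_dJ: "z \<in> S \<Longrightarrow> linear (\<lambda>x. dJ z x e)"
  using has_derivative_J has_derivative_linear by blast

lemma linear_dJ2:
  assumes "z \<in> S"
  shows "linear (dJ z x)"
proof -
  have *: "dJ z x (r *\<^sub>R e + f) = r *\<^sub>R dJ z x e + dJ z x f" for r e f
  proof -
    have "((\<lambda>y. r *\<^sub>R J y e + J y f) has_derivative (\<lambda>x. r *\<^sub>R dJ z x e + dJ z x f)) (at z)"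
      using assms by (intro has_derivative_add has_derivative_scaleR_right has_derivative_J)
    then have "((\<lambda>y. J y (r *\<^sub>R e + f)) has_derivative (\<lambda>x. r *\<^sub>R dJ z x e + dJ z x f)) (at z)"
      by (rule has_derivative_transform_within_open[OF _ open_S assms])
         (simp add: linear_add[OF linear_J] linear_cmul[OF linear_J])
    from has_derivative_unique[OF this has_derivative_J[OF assms]] show ?thesis by metis
  qed
  show ?thesis
    by (rule linearI) (use *[of 1] *[of _ _ 0] *[of 1 0 0] in auto)
qed

text \<open>Product rule. Only the derivative of \<open>J y e\<close> for fixed \<open>e\<close> is
  given, so \<open>X y\<close> is expanded in a basis with scalar coefficients.\<close>

lemma has_derivative_J_field:
  assumes "z \<in> S" "(X has_derivative X') (at z)"
  shows "((\<lambda>y. J y (X y)) has_derivative (\<lambda>x. dJ z x (X z) + J z (X' x))) (at z)"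
proof -
  have "((\<lambda>y. \<Sum>b\<in>Basis. (X y \<bullet> b) *\<^sub>R J y b) has_derivative
      (\<lambda>x. \<Sum>b\<in>Basis. (X z \<bullet> b) *\<^sub>R dJ z x b + (X' x \<bullet> b) *\<^sub>R J z b)) (at z)"
    using assms by (intro has_derivative_sum has_derivative_scaleR has_derivative_inner_left has_derivative_J)
  then have "((\<lambda>y. J y (X y)) has_derivative
      (\<lambda>x. \<Sum>b\<in>Basis. (X z \<bullet> b) *\<^sub>R dJ z x b + (X' x \<bullet> b) *\<^sub>R J z b)) (at z)"
    by (rule has_derivative_transform_within_open[OF _ open_S assms(1)])
       (rule linear_euclidean_expansion[OF linear_J, symmetric])
  then show ?thesis
    by (simp add: sum.distrib linear_euclidean_expansion[OF linear_J[OF assms(1)], symmetric]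
        linear_euclidean_expansion[OF linear_dJ2[OF assms(1)], symmetric])
qed

text \<open>Differentiate \<open>J (J e) = - e\<close>: the derivative of \<open>J\<close>
  anticommutes with \<open>J\<close>.\<close>

lemma dJ_J:
  assumes "z \<in> S"
  shows "dJ z x (J z e) = - J z (dJ z x e)"
proof -
  have "((\<lambda>y. J y (J y e)) has_derivative (\<lambda>x. dJ z x (J z e) + J z (dJ z x e))) (at z)"
    by (rule has_derivative_J_field[OF assms has_derivative_J[OF assms]])
  moreover have "((\<lambda>y. - e) has_derivative (\<lambda>x. 0)) (at z)" by simp
  then have "((\<lambda>y. J y (J y e)) has_derivative (\<lambda>x. 0)) (at z)"
    by (rule has_derivative_transform_within_open[OF _ open_S assms]) (simp add: J_J)
  ultimately have "(\<lambda>x. dJ z x (J z e) + J z (dJ z x e)) = (\<lambda>x. 0)"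
    by (rule has_derivative_unique)
  then show ?thesis by (metis eq_neg_iff_add_eq_0)
qed

text \<open>Tensoriality of N: all terms containing derivatives of \<open>X\<close> or
  \<open>Y\<close> cancel by \<open>J_J\<close>, which leaves the value on the constant fields
  \<open>X z\<close> and \<open>Y z\<close>.\<close>

lemma nijenhuis_eq_torsion:
  assumes z: "z \<in> S" and X: "X differentiable (at z)" and Y: "Y differentiable (at z)"
  defines "JX \<equiv> \<lambda>y. J y (X y)" and "JY \<equiv> \<lambda>y. J y (Y y)"
  shows "bracket JX JY z - J z (bracket JX Y z) - J z (bracket X JY z) - bracket X Y z
    = torsion z (X z) (Y z)"
proof -
  let ?X = "frechet_derivative X (at z)" and ?Y = "frechet_derivative Y (at z)"
  have JX: "frechet_derivative JX (at z) = (\<lambda>x. dJ z x (X z) + J z (?X x))"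
    unfolding JX_def using X unfolding frechet_derivative_works
    by (intro frechet_derivative_at[symmetric] has_derivative_J_field z)
  have JY: "frechet_derivative JY (at z) = (\<lambda>x. dJ z x (Y z) + J z (?Y x))"
    unfolding JY_def using Y unfolding frechet_derivative_works
    by (intro frechet_derivative_at[symmetric] has_derivative_J_field z)
  show ?thesis
    unfolding bracket_def JX JY torsion_def
    by (simp add: JX_def JY_def J_J[OF z] linear_add[OF linear_J[OF z]] linear_diff[OF linear_J[OF z]])
qed

lemma torsion_antisym: "torsion z f e = - torsion z e f"
  by (simp add: torsion_def)

lemma torsion_add:
  assumes "z \<in> S"
  shows "torsion z (e + e') f = torsion z e f + torsion z e' f"
  by (simp add: torsion_def linear_add[OF linear_J[OF assms]] linear_add[OF linear_dJ[OF assms]]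
      linear_add[OF linear_dJ2[OF assms]])

lemma torsion_J:
  assumes "z \<in> S"
  shows "torsion z (J z e) f = - J z (torsion z e f)"
  by (simp add: torsion_def J_J[OF assms] dJ_J[OF assms] linear_neg[OF linear_dJ[OF assms]]
      linear_neg[OF linear_J[OF assms]] linear_add[OF linear_J[OF assms]] linear_diff[OF linear_J[OF assms]])

text \<open>The torsion is complex antilinear in each argument.\<close>

lemma torsion_eq_0_if_generating:
  assumes z: "z \<in> S"
    and span: "\<And>e. \<exists>u v. e = H u + J z (H v)"
    and H: "\<And>u v. torsion z (H u) (H v) = 0"
  shows "torsion z e f = 0"
proof -
  have 1: "torsion z e (H v) = 0" for e v
  proof -
    obtain u w where "e = H u + J z (H w)" using span by blast
    then show ?thesis
      by (simp add: torsion_add[OF z] torsion_J[OF z] H linear_0[OF linear_J[OF z]])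
  qed
  obtain u v where f: "f = H u + J z (H v)" using span by blast
  have "torsion z (H u) e = 0" "torsion z (H v) e = 0"
    using 1[of e] torsion_antisym[of z e] by simp_all
  then have "torsion z f e = 0"
    by (simp add: f torsion_add[OF z] torsion_J[OF z] linear_0[OF linear_J[OF z]])
  then show ?thesis using torsion_antisym[of z f e] by simp
qed

end

text \<open>An algebraic curvature tensor is determined by its sectional curvatures. It will be
  applied to the difference between the curvature of the metric and the model of constant curvature
  \<open>c\<close>.\<close>

lemma curvature_like_eq_0:
  fixes R :: "'v::real_vector \<Rightarrow> 'v \<Rightarrow> 'v \<Rightarrow> 'v \<Rightarrow> real"
  assumes add: "\<And>u u' v w s. R (u + u') v w s = R u v w s + R u' v w s"
      "\<And>u v v' w s. R u (v + v') w s = R u v w s + R u v' w s"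
      "\<And>u v w w' s. R u v (w + w') s = R u v w s + R u v w' s"
      "\<And>u v w s s'. R u v w (s + s') = R u v w s + R u v w s'"
    and skew: "\<And>u v w s. R v u w s = - R u v w s" "\<And>u v w s. R u v s w = - R u v w s"
    and bianchi: "\<And>u v w s. R u v w s + R v w u s + R w u v s = 0"
    and diag: "\<And>u v. R u v v u = 0"
  shows "R u v w s = 0"
proof -
  \<comment> \<open>The classical octahedron argument: the four cyclic identities obtained by
    omitting each argument in turn, combined through skew symmetry.\<close>
  have pair: "R u v w s = R w s u v" for u v w s
    using bianchi[of u v w s] bianchi[of v w s u] bianchi[of w s u v] bianchi[of s u v w]
      skew(1)[of u v] skew(2)[of u v] skew(1)[of v w] skew(2)[of v w] skew(1)[of w s] skew(2)[of w s]
      skew(1)[of s u] skew(2)[of s u] skew(1)[of u w] skew(2)[of u w] skew(1)[of v s] skew(2)[of v s]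
    by (smt (verit))
  \<comment> \<open>Polarise \<open>diag\<close> in the outer variable. The two cross terms are
    equal by \<open>pair\<close> and skew symmetry, so twice either one is 0.\<close>
  have 1: "R u v v s = 0" for u v s
    using diag[of "u + s" v] diag[of u v] diag[of s v] pair[of s v v u] skew(1)[of v u s v] skew(2)[of u v v s]
    by (simp add: add)
  \<comment> \<open>Polarising once more in the middle pair makes \<open>R\<close> alternating in
    its first three arguments; the cyclic sum is then three times one term.\<close>
  have "R u v w s = - R u w v s" for u v w s
    using 1[of u "v + w" s] 1[of u v s] 1[of u w s] by (simp add: add)
  then show ?thesis
    using bianchi[of u v w s] skew(1) by (smt (verit))
qed

section \<open>The metric in a chart\<close>

lemma bounded_bilinear_matrix_vector_mult:
  "bounded_bilinear (\<lambda>(A::real^'n^'m) x. A *v x)"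
  unfolding bilinear_conv_bounded_bilinear[symmetric] bilinear_def
  by (auto intro!: linearI simp: matrix_vector_mult_add_rdistrib matrix_vector_right_distrib
      matrix_vector_mult_scaleR scaleR_matrix_vector_assoc)

lemma has_derivative_vec_nth:
  fixes f :: "'a::real_normed_vector \<Rightarrow> 'b::euclidean_space^'n"
  assumes "\<And>i. ((\<lambda>x. f x $ i) has_derivative (\<lambda>x. f' x $ i)) (at a)"
  shows "(f has_derivative f') (at a)"
  by (rule has_derivative_componentwise_within[THEN iffD2])
     (auto simp: Basis_vec_def inner_axis intro!: has_derivative_inner_left assms)

lemma differentiable_vec_nth:
  fixes f :: "'a::real_normed_vector \<Rightarrow> 'b::euclidean_space^'n"
  assumes "\<And>i. (\<lambda>x. f x $ i) differentiable (at a)"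
  shows "f differentiable (at a)"
proof -
  obtain f' where "((\<lambda>x. f x $ i) has_derivative f' i) (at a)" for i
    using assms unfolding differentiable_def by metis
  then have "(f has_derivative (\<lambda>x. \<chi> i. f' i x)) (at a)"
    by (intro has_derivative_vec_nth) simp
  then show ?thesis by (rule differentiableI)
qed

lemma differentiable_transform_open:
  assumes "f differentiable (at x)" "open S" "x \<in> S" "\<And>y. y \<in> S \<Longrightarrow> f y = g y"
  shows "g differentiable (at x)"
  using assms unfolding differentiable_def by (meson has_derivative_transform_within_open)

lemma differentiable_prod:
  fixes f :: "'i \<Rightarrow> 'a::real_normed_vector \<Rightarrow> real"
  assumes "\<And>i. i \<in> I \<Longrightarrow> f i differentiable (at x)"
  shows "(\<lambda>x. \<Prod>i\<in>I. f i x) differentiable (at x)"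
  using assms by (induction I rule: infinite_finite_induct) auto

lemma differentiable_det:
  fixes M :: "'a::real_normed_vector \<Rightarrow> real^'n^'n"
  assumes "\<And>i j. (\<lambda>x. M x $ i $ j) differentiable (at x)"
  shows "(\<lambda>x. det (M x)) differentiable (at x)"
  unfolding det_def using assms
  by (intro differentiable_sum ballI differentiable_mult differentiable_const differentiable_prod) auto

lemma inner_matrix_vector_symmetric:
  fixes A :: "real^'n^'n"
  assumes "\<And>i j. A $ i $ j = A $ j $ i"
  shows "(A *v u) \<bullet> v = (A *v v) \<bullet> u"
proof -
  have "transpose A = A" using assms by (simp add: transpose_def vec_eq_iff)
  then show ?thesis
    by (metis dot_lmul_matrix inner_commute vector_transpose_matrix)
qed

lemma differentiable_linear_family:
  fixes L :: "'a::real_normed_vector \<Rightarrow> real^'n \<Rightarrow> 'b::real_normed_vector"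
  assumes "\<And>z. linear (L z)" "\<And>b. (\<lambda>z. L z b) differentiable (at x)" "f differentiable (at x)"
  shows "(\<lambda>z. L z (f z)) differentiable (at x)"
proof -
  have "(\<lambda>z. f z $ i) differentiable (at x)" for i
    using assms(3) bounded_linear_vec_nth[of i] by (auto simp: differentiable_def intro: bounded_linear.has_derivative)
  then have "(\<lambda>z. \<Sum>i\<in>UNIV. (f z $ i) *\<^sub>R L z (axis i 1)) differentiable (at x)"
    by (intro differentiable_sum ballI differentiable_scaleR assms(2)) auto
  then show ?thesis by (simp flip: linear_axis_expansion[OF assms(1)])
qed

locale local_metric =
  fixes U :: "(real^'n) set" and G :: "real^'n \<Rightarrow> real^'n^'n"
  assumes open_U: "open U"
    and smooth_G: "smooth_on U (\<lambda>q. G q $ i $ j)"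
    and sym_G: "q \<in> U \<Longrightarrow> G q $ i $ j = G q $ j $ i"
    and pos_G: "q \<in> U \<Longrightarrow> v \<noteq> 0 \<Longrightarrow> v \<bullet> (G q *v v) > 0"
begin

abbreviation Ginv :: "real^'n \<Rightarrow> real^'n^'n" where "Ginv q \<equiv> matrix_inv (G q)"

lemma G_symmetric: "q \<in> U \<Longrightarrow> (G q *v u) \<bullet> v = (G q *v v) \<bullet> u"
  by (intro inner_matrix_vector_symmetric sym_G)

lemma invertible_G:
  assumes "q \<in> U"
  shows "invertible (G q)"
proof -
  have "x = 0" if "G q *v x = 0" for x
    using pos_G[OF assms, of x] that by auto
  then show ?thesis
    unfolding invertible_left_inverse matrix_left_invertible_ker by blast
qed

lemma matrix_inv_G:
  assumes "q \<in> U"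
  shows "G q ** Ginv q = mat 1" "Ginv q ** G q = mat 1"
  using someI_ex[OF invertible_G[OF assms, unfolded invertible_def]]
  by (simp_all add: matrix_inv_def)

lemma G_Ginv [simp]: "q \<in> U \<Longrightarrow> G q *v (Ginv q *v p) = p"
  by (simp add: matrix_vector_mul_assoc matrix_inv_G)

lemma Ginv_G [simp]: "q \<in> U \<Longrightarrow> Ginv q *v (G q *v u) = u"
  by (simp add: matrix_vector_mul_assoc matrix_inv_G)

lemma Ginv_symmetric:
  assumes "q \<in> U"
  shows "(Ginv q *v u) \<bullet> v = (Ginv q *v v) \<bullet> u"
  using G_symmetric[OF assms, of "Ginv q *v u" "Ginv q *v v"] assms by (simp add: inner_commute)

lemma sym_Ginv:
  assumes "q \<in> U"
  shows "Ginv q $ i $ j = Ginv q $ j $ i"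
  using Ginv_symmetric[OF assms, of "axis i 1" "axis j 1"]
  by (simp add: inner_axis matrix_vector_mul_component)

section \<open>First derivatives of the metric and of its inverse\<close>

definition dG :: "real^'n \<Rightarrow> real^'n \<Rightarrow> real^'n^'n" where
  "dG q x = (\<chi> i j. frechet_derivative (\<lambda>q. G q $ i $ j) (at q) x)"

lemma has_derivative_G_component:
  "q \<in> U \<Longrightarrow> ((\<lambda>q. G q $ i $ j) has_derivative (\<lambda>x. dG q x $ i $ j)) (at q)"
  using smooth_onD_has_derivative[OF open_U smooth_G] by (simp add: dG_def)

lemma has_derivative_G: "q \<in> U \<Longrightarrow> (G has_derivative dG q) (at q)"
  by (intro has_derivative_vec_nth has_derivative_G_component)

lemma partial_G: "partial k (\<lambda>q. G q $ i $ j) q = dG q (axis k 1) $ i $ j"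
  by (simp add: partial_def dG_def)

lemma sym_dG:
  assumes "q \<in> U"
  shows "dG q x $ i $ j = dG q x $ j $ i"
proof -
  have "frechet_derivative (\<lambda>q. G q $ i $ j) (at q) = frechet_derivative (\<lambda>q. G q $ j $ i) (at q)"
    by (rule frechet_derivative_at[OF has_derivative_transform_within_open[OF
          smooth_onD_has_derivative[OF open_U smooth_G assms] open_U assms sym_G]])
  then show ?thesis by (simp add: dG_def)
qed

lemma dG_symmetric: "q \<in> U \<Longrightarrow> (dG q x *v u) \<bullet> v = (dG q x *v v) \<bullet> u"
  by (intro inner_matrix_vector_symmetric sym_dG)

lemma dG_expansion:
  assumes "q \<in> U"
  shows "(dG q x *v y) \<bullet> z = (\<Sum>i\<in>UNIV. \<Sum>j\<in>UNIV. \<Sum>k\<in>UNIV. dG q (axis i 1) $ j $ k * x$i * y$j * z$k)"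
proof -
  have "(dG q x *v y) \<bullet> z = (\<Sum>k\<in>UNIV. \<Sum>j\<in>UNIV. dG q x $ j $ k * y$j * z$k)"
    by (simp add: inner_vec_def matrix_vector_mult_def sum_distrib_right sym_dG[OF assms, of x])
  also have "\<dots> = (\<Sum>j\<in>UNIV. \<Sum>k\<in>UNIV. dG q x $ j $ k * y$j * z$k)"
    by (rule sum.swap)
  also have "\<dots> = (\<Sum>j\<in>UNIV. \<Sum>k\<in>UNIV. \<Sum>i\<in>UNIV. dG q (axis i 1) $ j $ k * x$i * y$j * z$k)"
    by (subst linear_axis_expansion[OF has_derivative_linear[OF has_derivative_G[OF assms]], of x])
       (simp add: sum_distrib_left sum_distrib_right mult_ac)
  also have "\<dots> = (\<Sum>j\<in>UNIV. \<Sum>i\<in>UNIV. \<Sum>k\<in>UNIV. dG q (axis i 1) $ j $ k * x$i * y$j * z$k)"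
    by (intro sum.cong refl sum.swap)
  also have "\<dots> = (\<Sum>i\<in>UNIV. \<Sum>j\<in>UNIV. \<Sum>k\<in>UNIV. dG q (axis i 1) $ j $ k * x$i * y$j * z$k)"
    by (rule sum.swap)
  finally show ?thesis .
qed

text \<open>Cramer's rule writes the entries of the inverse as quotients of determinants in the
  entries of \<open>G\<close>.\<close>

lemma differentiable_Ginv_component:
  assumes "q \<in> U"
  shows "(\<lambda>q. Ginv q $ k $ l) differentiable (at q)"
proof -
  have det: "det (G q) \<noteq> 0" if "q \<in> U" for q
    using invertible_G[OF that] invertible_det_nz by blast
  have dG: "(\<lambda>q. G q $ i $ j) differentiable (at q)" for i j
    using has_derivative_G_component[OF assms] by (rule differentiableI)
  have "(\<lambda>q. det (\<chi> i j. if j = k then axis l 1 $ i else G q $ i $ j) / det (G q)) differentiable (at q)"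
  proof (intro differentiable_divide differentiable_det dG det assms)
    show "(\<lambda>q. (\<chi> i j. if j = k then axis l 1 $ i else G q $ i $ j) $ i $ j) differentiable at q" for i j
      by (cases "j = k") (simp_all add: dG)
  qed
  then show ?thesis
  proof (rule differentiable_transform_open[OF _ open_U assms])
    fix y assume y: "y \<in> U"
    have "Ginv y *v axis l 1 = (\<chi> k. det (\<chi> i j. if j = k then axis l 1 $ i else G y $ i $ j) / det (G y))"
      unfolding cramer[OF det[OF y], symmetric] using y by simp
    then show "det (\<chi> i j. if j = k then axis l 1 $ i else G y $ i $ j) / det (G y) = Ginv y $ k $ l"
      by (simp add: vec_eq_iff matrix_vector_mul_component inner_axis)
  qed
qed

text \<open>The covariant derivative of the constant field \<open>v\<close> along \<open>u\<close>.
  Treating the Christoffel symbols as a vector-valued bilinear map turns the later index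
  computations into vector identities; in \<open>dChr\<close> the argument after the point is the
  direction of differentiation.\<close>

definition Chr :: "real^'n \<Rightarrow> real^'n \<Rightarrow> real^'n \<Rightarrow> real^'n" where
  "Chr q u v = (\<chi> k. \<Sum>i\<in>UNIV. \<Sum>j\<in>UNIV. christoffel G q k i j * u$i * v$j)"

definition dChr :: "real^'n \<Rightarrow> real^'n \<Rightarrow> real^'n \<Rightarrow> real^'n \<Rightarrow> real^'n" where
  "dChr q x u v = (\<chi> k. \<Sum>i\<in>UNIV. \<Sum>j\<in>UNIV.
     frechet_derivative (\<lambda>q. christoffel G q k i j) (at q) x * u$i * v$j)"

lemma christoffel_sym: "q \<in> U \<Longrightarrow> christoffel G q k i j = christoffel G q k j i"
  by (simp add: christoffel_def partial_G sym_dG[of q _ i j] add.commute)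

lemma differentiable_christoffel:
  assumes "q \<in> U"
  shows "(\<lambda>q. christoffel G q k i j) differentiable (at q)"
proof -
  have "(\<lambda>q. partial m (\<lambda>q. G q $ i $ j) q) differentiable (at q)" for m i j
    unfolding partial_def
    by (rule differentiableI[OF smooth_onD_has_derivative[OF open_U smooth_on_derivative[OF open_U smooth_G] assms]])
  then show ?thesis
    unfolding christoffel_def
    by (intro differentiable_mult differentiable_const differentiable_sum ballI differentiable_add differentiable_diff
        differentiable_Ginv_component assms) auto
qed

lemma has_derivative_christoffel:
  "q \<in> U \<Longrightarrow> ((\<lambda>q. christoffel G q k i j) has_derivative
     frechet_derivative (\<lambda>q. christoffel G q k i j) (at q)) (at q)"
  using differentiable_christoffel by (simp flip: frechet_derivative_works)

lemma has_derivative_Chr: "q \<in> U \<Longrightarrow> ((\<lambda>q. Chr q u v) has_derivative (\<lambda>x. dChr q x u v)) (at q)"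
  by (rule has_derivative_vec_nth)
     (auto simp: Chr_def dChr_def intro!: has_derivative_sum has_derivative_mult_left has_derivative_christoffel)

lemma Chr_commute: "q \<in> U \<Longrightarrow> Chr q u v = Chr q v u"
  unfolding Chr_def by (subst sum.swap) (simp add: christoffel_sym[of q _ _ i for i] mult_ac)

lemma dChr_commute:
  assumes "q \<in> U"
  shows "dChr q x u v = dChr q x v u"
proof -
  have "((\<lambda>q. Chr q v u) has_derivative (\<lambda>x. dChr q x u v)) (at q)"
    by (rule has_derivative_transform_within_open[OF has_derivative_Chr[OF assms] open_U assms Chr_commute])
  from has_derivative_unique[OF this has_derivative_Chr[OF assms]] show ?thesis by metis
qed

lemma Chr_add_left: "Chr q (u + u') v = Chr q u v + Chr q u' v"
  and Chr_add_right: "Chr q u (v + v') = Chr q u v + Chr q u v'"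
  and dChr_add_left: "dChr q x (u + u') v = dChr q x u v + dChr q x u' v"
  and dChr_add_right: "dChr q x u (v + v') = dChr q x u v + dChr q x u v'"
  by (simp_all add: Chr_def dChr_def vec_eq_iff algebra_simps sum.distrib)

lemma linear_Chr: "linear (Chr q u)"
  by (rule linearI) (simp_all add: Chr_def vec_eq_iff sum.distrib sum_distrib_left algebra_simps)

lemma linear_dChr: "linear (dChr q x u)"
  by (rule linearI) (simp_all add: dChr_def vec_eq_iff sum.distrib sum_distrib_left algebra_simps)

lemma dChr_add: "q \<in> U \<Longrightarrow> dChr q (x + x') u v = dChr q x u v + dChr q x' u v"
  using has_derivative_linear[OF has_derivative_Chr] linear_add by blast

lemma dChr_zero: "q \<in> U \<Longrightarrow> dChr q 0 u v = 0"
  using linear_0[OF has_derivative_linear[OF has_derivative_Chr]] .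

text \<open>Koszul's formula for constant fields, whose brackets vanish. The auxiliary
  \<open>L\<close> is the covector obtained by lowering the index of
  \<open>Chr q u v\<close>.\<close>

lemma Chr_lowered:
  assumes "q \<in> U"
  shows "(G q *v Chr q u v) \<bullet> w = ((dG q u *v v) \<bullet> w + (dG q v *v u) \<bullet> w - (dG q w *v u) \<bullet> v) / 2"
proof -
  define d where "d i j l = dG q (axis i 1) $ j $ l + dG q (axis j 1) $ i $ l - dG q (axis l 1) $ i $ j" for i j l
  define L :: "real^'n" where "L = (\<chi> l. (\<Sum>i\<in>UNIV. \<Sum>j\<in>UNIV. d i j l * u$i * v$j) / 2)"
  have "Chr q u v $ k = (Ginv q *v L) $ k" for k
  proof -
    have "Chr q u v $ k = (\<Sum>i\<in>UNIV. \<Sum>j\<in>UNIV. \<Sum>l\<in>UNIV. Ginv q $ k $ l * (d i j l * u$i * v$j / 2))"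
      by (simp add: Chr_def christoffel_def partial_G d_def sum_distrib_left sum_distrib_right mult_ac)
    also have "\<dots> = (\<Sum>i\<in>UNIV. \<Sum>l\<in>UNIV. \<Sum>j\<in>UNIV. Ginv q $ k $ l * (d i j l * u$i * v$j / 2))"
      by (intro sum.cong refl sum.swap)
    also have "\<dots> = (\<Sum>l\<in>UNIV. \<Sum>i\<in>UNIV. \<Sum>j\<in>UNIV. Ginv q $ k $ l * (d i j l * u$i * v$j / 2))"
      by (rule sum.swap)
    also have "\<dots> = (Ginv q *v L) $ k"
      by (simp add: L_def matrix_vector_mult_def sum_distrib_left sum_divide_distrib)
    finally show ?thesis .
  qed
  then have "Chr q u v = Ginv q *v L" by (simp add: vec_eq_iff)
  then have "(G q *v Chr q u v) \<bullet> w = L \<bullet> w" using assms by simp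
  also have "\<dots> = (\<Sum>l\<in>UNIV. \<Sum>i\<in>UNIV. \<Sum>j\<in>UNIV. d i j l * u$i * v$j * w$l) / 2"
    by (simp add: L_def inner_vec_def sum_distrib_right sum_divide_distrib)
  also have "(\<Sum>l\<in>UNIV. \<Sum>i\<in>UNIV. \<Sum>j\<in>UNIV. d i j l * u$i * v$j * w$l)
      = (\<Sum>l\<in>UNIV. \<Sum>i\<in>UNIV. \<Sum>j\<in>UNIV. dG q (axis i 1) $ j $ l * u$i * v$j * w$l)
      + (\<Sum>l\<in>UNIV. \<Sum>i\<in>UNIV. \<Sum>j\<in>UNIV. dG q (axis j 1) $ i $ l * v$j * u$i * w$l)
      - (\<Sum>l\<in>UNIV. \<Sum>i\<in>UNIV. \<Sum>j\<in>UNIV. dG q (axis l 1) $ i $ j * w$l * u$i * v$j)"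
    by (simp add: d_def algebra_simps sum.distrib sum_subtractf)
  also have "(\<Sum>l\<in>UNIV. \<Sum>i\<in>UNIV. \<Sum>j\<in>UNIV. dG q (axis l 1) $ i $ j * w$l * u$i * v$j) = (dG q w *v u) \<bullet> v"
    by (simp add: dG_expansion[OF assms])
  also have "(\<Sum>l\<in>UNIV. \<Sum>i\<in>UNIV. \<Sum>j\<in>UNIV. dG q (axis i 1) $ j $ l * u$i * v$j * w$l) = (dG q u *v v) \<bullet> w"
    unfolding dG_expansion[OF assms] by (subst sum.swap) (intro sum.cong refl sum.swap)
  also have "(\<Sum>l\<in>UNIV. \<Sum>i\<in>UNIV. \<Sum>j\<in>UNIV. dG q (axis j 1) $ i $ l * v$j * u$i * w$l)
      = (\<Sum>l\<in>UNIV. \<Sum>j\<in>UNIV. \<Sum>i\<in>UNIV. dG q (axis j 1) $ i $ l * v$j * u$i * w$l)"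
    by (intro sum.cong refl sum.swap)
  also have "\<dots> = (dG q v *v u) \<bullet> w"
    unfolding dG_expansion[OF assms] by (subst sum.swap) (intro sum.cong refl sum.swap)
  finally show ?thesis .
qed

text \<open>The metric is parallel: of the six Koszul terms on the right, four cancel in pairs and
  the other two are equal.\<close>

lemma metric_compatible:
  assumes "q \<in> U"
  shows "(dG q x *v u) \<bullet> v = (G q *v Chr q x u) \<bullet> v + (G q *v Chr q x v) \<bullet> u"
  using assms by (simp add: Chr_lowered dG_symmetric[of q _ u v] dG_symmetric[of q _ x] field_simps)

text \<open>R(u,v)w for constant fields, so that no term with \<open>[u, v]\<close> occurs. Each
  second covariant derivative contributes the derivative of \<open>Chr\<close> and one iterated
  \<open>Chr\<close>.\<close>

definition Riem :: "real^'n \<Rightarrow> real^'n \<Rightarrow> real^'n \<Rightarrow> real^'n \<Rightarrow> real^'n" where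
  "Riem q u v w = Chr q u (Chr q v w) + dChr q u v w - Chr q v (Chr q u w) - dChr q v u w"

lemma Riem_component:
  assumes "q \<in> U"
  shows "Riem q u v w $ l = (\<Sum>i\<in>UNIV. \<Sum>j\<in>UNIV. \<Sum>k\<in>UNIV. riemann G q l k i j * u$i * v$j * w$k)"
proof -
  have C: "Chr q u (Chr q v w) $ l = (\<Sum>i\<in>UNIV. \<Sum>j\<in>UNIV. \<Sum>k\<in>UNIV.
      (\<Sum>s\<in>UNIV. christoffel G q l i s * christoffel G q s j k) * u$i * v$j * w$k)" for u v
  proof -
    have "Chr q u (Chr q v w) $ l = (\<Sum>i\<in>UNIV. \<Sum>s\<in>UNIV. \<Sum>j\<in>UNIV. \<Sum>k\<in>UNIV.
        christoffel G q l i s * christoffel G q s j k * u$i * v$j * w$k)"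
      by (simp add: Chr_def sum_distrib_left mult_ac)
    also have "\<dots> = (\<Sum>i\<in>UNIV. \<Sum>j\<in>UNIV. \<Sum>s\<in>UNIV. \<Sum>k\<in>UNIV.
        christoffel G q l i s * christoffel G q s j k * u$i * v$j * w$k)"
      by (intro sum.cong refl sum.swap)
    also have "\<dots> = (\<Sum>i\<in>UNIV. \<Sum>j\<in>UNIV. \<Sum>k\<in>UNIV. \<Sum>s\<in>UNIV.
        christoffel G q l i s * christoffel G q s j k * u$i * v$j * w$k)"
      by (intro sum.cong refl sum.swap)
    finally show ?thesis by (simp add: sum_distrib_right)
  qed
  have d: "dChr q u v w $ l = (\<Sum>i\<in>UNIV. \<Sum>j\<in>UNIV. \<Sum>k\<in>UNIV.
      partial i (\<lambda>q. christoffel G q l j k) q * u$i * v$j * w$k)" for u v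
  proof -
    have "dChr q u v w $ l = (\<Sum>j\<in>UNIV. \<Sum>k\<in>UNIV. \<Sum>i\<in>UNIV.
        partial i (\<lambda>q. christoffel G q l j k) q * u$i * v$j * w$k)"
      unfolding dChr_def
      by (subst linear_axis_expansion[OF has_derivative_linear[OF has_derivative_christoffel[OF assms]], of _ _ _ u])
         (simp add: partial_def sum_distrib_left sum_distrib_right mult_ac)
    also have "\<dots> = (\<Sum>j\<in>UNIV. \<Sum>i\<in>UNIV. \<Sum>k\<in>UNIV.
        partial i (\<lambda>q. christoffel G q l j k) q * u$i * v$j * w$k)"
      by (intro sum.cong refl sum.swap)
    also have "\<dots> = (\<Sum>i\<in>UNIV. \<Sum>j\<in>UNIV. \<Sum>k\<in>UNIV.
        partial i (\<lambda>q. christoffel G q l j k) q * u$i * v$j * w$k)"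
      by (rule sum.swap)
    finally show ?thesis .
  qed
  have swap: "(\<Sum>i\<in>UNIV. \<Sum>j\<in>UNIV. \<Sum>k\<in>UNIV. f i j k * v$i * u$j * w$k)
      = (\<Sum>i\<in>UNIV. \<Sum>j\<in>UNIV. \<Sum>k\<in>UNIV. f j i k * u$i * v$j * w$k)" for f :: "'n \<Rightarrow> 'n \<Rightarrow> 'n \<Rightarrow> real"
    by (subst sum.swap) (simp add: mult_ac)
  show ?thesis
    by (simp add: Riem_def C[of u v] d[of u v] C[of v u, unfolded swap] d[of v u, unfolded swap] riemann_def
        sum_subtractf sum.distrib algebra_simps)
qed

lemma Riem_skew: "Riem q v u w = - Riem q u v w"
  by (simp add: Riem_def)

lemma Riem_bianchi:
  assumes "q \<in> U"
  shows "Riem q u v w + Riem q v w u + Riem q w u v = 0"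
  by (simp add: Riem_def Chr_commute[OF assms, of u v] Chr_commute[OF assms, of v w] Chr_commute[OF assms, of u w]
      dChr_commute[OF assms, of _ u v] dChr_commute[OF assms, of _ v w] dChr_commute[OF assms, of _ u w])

lemma Riem_add:
  assumes "q \<in> U"
  shows "Riem q (u + u') v w = Riem q u v w + Riem q u' v w"
    and "Riem q u (v + v') w = Riem q u v w + Riem q u v' w"
    and "Riem q u v (w + w') = Riem q u v w + Riem q u v w'"
  using assms by (simp_all add: Riem_def Chr_add_left Chr_add_right dChr_add_left dChr_add_right dChr_add)

text \<open>The second derivatives of the function g(w,w), for constant \<open>w\<close>, commute;
  by metric compatibility their commutator is 2 g(R(u,v)w, w).\<close>

lemma Riem_skew_metric:
  assumes q: "q \<in> U"
  shows "(G q *v Riem q u v w) \<bullet> w = 0"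
proof -
  define f where "f q = (G q *v w) \<bullet> w" for q
  have f_eq: "f q = (\<Sum>i\<in>UNIV. \<Sum>j\<in>UNIV. (G q $ i $ j) *\<^sub>R (w$j * w$i))" for q
    by (simp add: f_def inner_vec_def matrix_vector_mult_def sum_distrib_left sum_distrib_right mult_ac)
  have smooth: "smooth_on U f"
    unfolding f_eq
    by (intro smooth_on_sum smooth_on_scaleR smooth_on_const smooth_G open_U)
  have bl: "bounded_linear (\<lambda>M::real^'n^'n. M *v x)" for x
    by (rule bounded_bilinear.bounded_linear_left[OF bounded_bilinear_matrix_vector_mult])
  have df: "frechet_derivative f (at y) x = (G y *v Chr y x w) \<bullet> w * 2" if "y \<in> U" for x y
  proof -
    have "(f has_derivative (\<lambda>x. (dG y x *v w) \<bullet> w)) (at y)"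
      unfolding f_def using that
      by (intro has_derivative_inner_left bounded_linear.has_derivative[OF bl] has_derivative_G)
    then have "frechet_derivative f (at y) = (\<lambda>x. (dG y x *v w) \<bullet> w)"
      by (metis frechet_derivative_at)
    then show ?thesis using that by (simp add: metric_compatible)
  qed
  have ddf: "frechet_derivative (\<lambda>y. frechet_derivative f (at y) x) (at q) z
      = ((G q *v dChr q z x w + dG q z *v Chr q x w) \<bullet> w) * 2" for x z
  proof -
    have "((\<lambda>y. (G y *v Chr y x w) \<bullet> w * 2) has_derivative
        (\<lambda>z. ((G q *v dChr q z x w + dG q z *v Chr q x w) \<bullet> w) * 2)) (at q)"
      by (intro has_derivative_mult_left has_derivative_inner_left
          bounded_bilinear.FDERIV[OF bounded_bilinear_matrix_vector_mult] has_derivative_G has_derivative_Chr q)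
    then have "((\<lambda>y. frechet_derivative f (at y) x) has_derivative
        (\<lambda>z. ((G q *v dChr q z x w + dG q z *v Chr q x w) \<bullet> w) * 2)) (at q)"
      by (rule has_derivative_transform_within_open[OF _ open_U q]) (simp add: df)
    from fun_cong[OF frechet_derivative_at[OF this], of z] show ?thesis by simp
  qed
  \<comment> \<open>After \<open>dG\<close> is rewritten by metric compatibility, the products of
    two first-order terms are symmetric in \<open>u\<close> and \<open>v\<close> and drop
    out.\<close>
  have "(G q *v dChr q v u w + dG q v *v Chr q u w) \<bullet> w = (G q *v dChr q u v w + dG q u *v Chr q v w) \<bullet> w"
    using second_derivative_symmetric[OF open_U smooth q, of u v] unfolding ddf by simp
  then show ?thesis
    unfolding Riem_def
    using G_symmetric[OF q, of "Chr q u w" "Chr q v w"]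
    by (simp add: inner_add_left inner_diff_left matrix_vector_right_distrib matrix_vector_mult_diff_distrib metric_compatible[OF q])
qed

lemma Riem_scaleR:
  assumes "q \<in> U"
  shows "Riem q (r *\<^sub>R u) v w = r *\<^sub>R Riem q u v w"
proof -
  have C: "Chr q (r *\<^sub>R u) v = r *\<^sub>R Chr q u v" "dChr q x (r *\<^sub>R u) v = r *\<^sub>R dChr q x u v" for u v x
    by (simp_all add: Chr_def dChr_def vec_eq_iff sum_distrib_left mult_ac)
  then have C2: "Chr q u (r *\<^sub>R v) = r *\<^sub>R Chr q u v" for u v
    using Chr_commute[OF assms] by metis
  have "dChr q (r *\<^sub>R x) u v = r *\<^sub>R dChr q x u v" for x u v
    using linear_cmul[OF has_derivative_linear[OF has_derivative_Chr[OF assms]]] .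
  then show ?thesis
    by (simp add: Riem_def C C2 algebra_simps)
qed

text \<open>Strict Cauchy-Schwarz. The vector \<open>x\<close> is g(v,v) times the part of
  \<open>u\<close> orthogonal to \<open>v\<close>; it is nonzero by independence, and its squared
  length is g(v,v) times the Gram determinant.\<close>

lemma gram_positive:
  assumes "q \<in> U" "u \<noteq> v" "independent {u, v}"
  shows "((G q *v u) \<bullet> u) * ((G q *v v) \<bullet> v) - ((G q *v u) \<bullet> v)\<^sup>2 > 0"
proof -
  let ?g = "\<lambda>x y. (G q *v x) \<bullet> y"
  define x where "x = ?g v v *\<^sub>R u - ?g u v *\<^sub>R v"
  have "v \<noteq> 0" using assms(3) dependent_zero[of "{u, v}"] by auto
  then have v: "?g v v > 0" using pos_G[OF assms(1)] by (simp add: inner_commute)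
  have "x \<noteq> 0"
  proof
    assume "x = 0"
    then have "?g v v *\<^sub>R u = ?g u v *\<^sub>R v" by (simp add: x_def)
    then have "u = (?g u v / ?g v v) *\<^sub>R v"
      using v by (metis divideR_right less_irrefl scaleR_scaleR divide_inverse_commute)
    then have "u \<in> span {v}" by (metis span_base span_scale singletonI)
    then show False using assms(2,3) by (simp add: independent_insert)
  qed
  then have "?g x x > 0" using pos_G[OF assms(1)] by (simp add: inner_commute)
  also have "?g x x = ?g v v * (?g u u * ?g v v - (?g u v)\<^sup>2)"
    using G_symmetric[OF assms(1), of u v]
    by (simp add: x_def matrix_vector_mult_diff_distrib matrix_vector_mult_scaleR inner_diff_left inner_diff_right
        power2_eq_square algebra_simps)
  finally show ?thesis using v by (simp add: zero_less_mult_iff)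
qed

lemma sectional_curvature_Riem:
  assumes "q \<in> U"
  shows "sectional_curvature G q u v
    = ((G q *v Riem q u v v) \<bullet> u) / (((G q *v u) \<bullet> u) * ((G q *v v) \<bullet> v) - ((G q *v u) \<bullet> v)\<^sup>2)"
proof -
  have "(\<chi> l. \<Sum>i\<in>UNIV. \<Sum>j\<in>UNIV. \<Sum>k\<in>UNIV. riemann G q l k i j * u$i * v$j * v$k) = Riem q u v v"
    by (simp add: vec_eq_iff Riem_component[OF assms])
  moreover have "x \<bullet> (G q *v y) = (G q *v x) \<bullet> y" for x y
    using G_symmetric[OF assms, of y x] by (simp add: inner_commute)
  ultimately show ?thesis
    by (simp add: sectional_curvature_def Let_def)
qed

text \<open>The model tensor on the right has all symmetries of a curvature tensor and satisfies the
  same diagonal condition, so the difference \<open>S\<close> vanishes by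
  \<open>curvature_like_eq_0\<close>. Nondegeneracy of the metric then removes the fourth
  argument.\<close>

lemma constant_sectional_curvature_iff:
  assumes q: "q \<in> U"
  shows "(\<forall>u v. u \<noteq> v \<and> independent {u, v} \<longrightarrow> sectional_curvature G q u v = c) \<longleftrightarrow>
    (\<forall>u v w. Riem q u v w = c *\<^sub>R (((G q *v v) \<bullet> w) *\<^sub>R u - ((G q *v u) \<bullet> w) *\<^sub>R v))"
    (is "?L \<longleftrightarrow> ?R")
proof
  let ?g = "\<lambda>x y. (G q *v x) \<bullet> y"
  assume R: ?R
  show ?L
  proof (intro allI impI)
    fix u v :: "real^'n" assume uv: "u \<noteq> v \<and> independent {u, v}"
    show "sectional_curvature G q u v = c"
      unfolding sectional_curvature_Riem[OF q] R[rule_format]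
      using gram_positive[OF q, of u v] uv G_symmetric[OF q, of u v]
      by (simp add: matrix_vector_mult_scaleR matrix_vector_mult_diff_distrib inner_diff_left
          power2_eq_square field_simps)
  qed
next
  let ?g = "\<lambda>x y. (G q *v x) \<bullet> y"
  assume L: ?L
  define S where "S u v w s = ?g (Riem q u v w) s - c * (?g v w * ?g u s - ?g u w * ?g v s)" for u v w s
  have "S u v w s = 0" for u v w s
  proof (rule curvature_like_eq_0[where R=S])
    fix u u' v v' w w' s s' :: "real^'n"
    show "S (u + u') v w s = S u v w s + S u' v w s" "S u (v + v') w s = S u v w s + S u v' w s"
      "S u v (w + w') s = S u v w s + S u v w' s" "S u v w (s + s') = S u v w s + S u v w s'"
      unfolding S_def Riem_add[OF q]
      by (simp_all add: matrix_vector_right_distrib inner_add_left inner_add_right algebra_simps)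
    show "S v u w s = - S u v w s"
      unfolding S_def Riem_skew[of q v u] by (simp add: matrix_vector_mult_scaleR[of _ "-1", simplified] inner_minus_left algebra_simps)
    \<comment> \<open>Skew symmetry in the last two arguments comes from polarising the vanishing of
      g(R(u,v)w, w).\<close>
    have "?g (Riem q u v (w + s)) (w + s) = 0" "?g (Riem q u v w) w = 0" "?g (Riem q u v s) s = 0"
      by (rule Riem_skew_metric[OF q])+
    then show "S u v s w = - S u v w s"
      unfolding S_def Riem_add[OF q]
      by (simp add: matrix_vector_right_distrib inner_add_left inner_add_right algebra_simps)
    have "?g (Riem q u v w) s + ?g (Riem q v w u) s + ?g (Riem q w u v) s = 0"
      using Riem_bianchi[OF q, of u v w] by (metis inner_add_left inner_zero_left matrix_vector_mult_0_right matrix_vector_right_distrib)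
    then show "S u v w s + S v w u s + S w u v s = 0"
      unfolding S_def using G_symmetric[OF q, of u v] G_symmetric[OF q, of v w] G_symmetric[OF q, of u w]
      by (simp add: algebra_simps)
    show "S u v v u = 0"
    proof (cases "u \<noteq> v \<and> independent {u, v}")
      case True
      then have "?g (Riem q u v v) u / (?g u u * ?g v v - (?g u v)\<^sup>2) = c"
        using L unfolding sectional_curvature_Riem[OF q] by blast
      then show ?thesis
        using gram_positive[OF q, of u v] True G_symmetric[OF q, of u v]
        by (simp add: S_def power2_eq_square field_simps)
    next
      case False
      have Rvv: "Riem q v v w = 0" for v w
        by (simp add: Riem_def)
      \<comment> \<open>A dependent pair spans no plane, so the hypothesis is silent about it; here
        both parts of \<open>S\<close> vanish on their own.\<close>
      have "v = 0 \<or> (\<exists>r. u = r *\<^sub>R v)"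
      proof (cases "u = v")
        case True
        then have "u = 1 *\<^sub>R v" by simp
        then show ?thesis by blast
      next
        case uv: False
        then have "v = 0 \<or> u \<in> span {v}"
          using False by (auto simp: independent_insert)
        then show ?thesis by (auto simp: span_singleton)
      qed
      then show ?thesis
      proof
        assume "v = 0"
        moreover have "Riem q u 0 0 = 0" using Riem_add(2)[OF q, of u 0 0 0] by simp
        ultimately show ?thesis by (simp add: S_def)
      next
        assume "\<exists>r. u = r *\<^sub>R v"
        then obtain r where "u = r *\<^sub>R v" ..
        then show ?thesis
          by (simp add: S_def Riem_scaleR[OF q] Rvv matrix_vector_mult_scaleR)
      qed
    qed
  qed
  show ?R
  proof (intro allI)
    fix u v w
    let ?x = "Riem q u v w - c *\<^sub>R (?g v w *\<^sub>R u - ?g u w *\<^sub>R v)"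
    have "(G q *v ?x) \<bullet> s = 0" for s
      using \<open>S u v w s = 0\<close>
      by (simp add: S_def matrix_vector_mult_diff_distrib matrix_vector_mult_scaleR inner_diff_left algebra_simps)
    then have "G q *v ?x = 0" by (metis inner_eq_zero_iff)
    then have "?x = 0" using Ginv_G[OF q, of ?x] by simp
    then show "Riem q u v w = c *\<^sub>R (?g v w *\<^sub>R u - ?g u w *\<^sub>R v)" by simp
  qed
qed

section \<open>Horizontal lifts and the energy density\<close>

definition Gam :: "(real^'n) \<times> (real^'n) \<Rightarrow> real^'n \<Rightarrow> real^'n" where
  "Gam z u = (\<chi> h. \<Sum>i\<in>UNIV. u$i * Gamma0 G z i h)"

definition dGam :: "(real^'n) \<times> (real^'n) \<Rightarrow> (real^'n) \<times> (real^'n) \<Rightarrow> real^'n \<Rightarrow> real^'n" where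
  "dGam z x u = (\<chi> h. snd x \<bullet> Chr (fst z) u (axis h 1) + snd z \<bullet> dChr (fst z) (fst x) u (axis h 1))"

lemma Gam_nth: "Gam (q, p) u $ h = p \<bullet> Chr q u (axis h 1)"
proof -
  have "p \<bullet> Chr q u (axis h 1) = (\<Sum>k\<in>UNIV. \<Sum>i\<in>UNIV. p$k * (christoffel G q k i h * u$i))"
    by (simp add: Chr_def inner_vec_def axis_def sum_distrib_left if_distrib cong: if_cong)
  also have "\<dots> = (\<Sum>i\<in>UNIV. \<Sum>k\<in>UNIV. p$k * (christoffel G q k i h * u$i))"
    by (rule sum.swap)
  finally show ?thesis
    by (simp add: Gam_def Gamma0_def sum_distrib_left mult_ac)
qed

text \<open>Index-free meaning of the symbols \<open>Gamma0\<close>: \<open>Gam z u\<close> is the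
  fibre component of the horizontal lift of \<open>u\<close>, and it is tested against
  \<open>w\<close> through the connection.\<close>

lemma Gam_inner: "Gam (q, p) u \<bullet> w = p \<bullet> Chr q u w"
  unfolding inner_linear_expansion[OF linear_Chr, of p q u w] by (simp add: inner_vec_def Gam_nth)

lemma dGam_inner: "dGam (q, p) x u \<bullet> w = snd x \<bullet> Chr q u w + p \<bullet> dChr q (fst x) u w"
  unfolding inner_linear_expansion[OF linear_Chr, of "snd x" q u w] inner_linear_expansion[OF linear_dChr, of p q "fst x" u w]
    inner_vec_def[of "dGam _ _ _"]
  by (simp add: dGam_def sum.distrib algebra_simps)

lemma linear_Gam: "linear (Gam z)"
  by (rule linearI) (simp_all add: Gam_def vec_eq_iff algebra_simps sum.distrib sum_distrib_left)

lemma has_derivative_Gam: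
  assumes "q \<in> U"
  shows "((\<lambda>z. Gam z u) has_derivative (\<lambda>x. dGam (q, p) x u)) (at (q, p))"
proof (rule has_derivative_vec_nth)
  fix h
  have "((\<lambda>z. Chr (fst z) u (axis h 1)) has_derivative (\<lambda>x. dChr q (fst x) u (axis h 1))) (at (q, p))"
    by (rule has_derivative_compose[where f=fst and g="\<lambda>q. Chr q u (axis h 1)"])
       (use has_derivative_Chr[OF assms] in \<open>auto intro!: derivative_eq_intros\<close>)
  then have "((\<lambda>z. snd z \<bullet> Chr (fst z) u (axis h 1)) has_derivative
      (\<lambda>x. p \<bullet> dChr q (fst x) u (axis h 1) + snd x \<bullet> Chr q u (axis h 1))) (at (q, p))"
    using has_derivative_inner[OF has_derivative_snd[OF has_derivative_ident]] by fastforce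
  moreover have "Gam z u $ h = snd z \<bullet> Chr (fst z) u (axis h 1)" for z
    by (cases z) (simp add: Gam_nth)
  ultimately show "((\<lambda>z. Gam z u $ h) has_derivative (\<lambda>x. dGam (q, p) x u $ h)) (at (q, p))"
    by (simp add: dGam_def add.commute)
qed

lemma energy_eq: "energy G (q, p) = ((Ginv q *v p) \<bullet> p) / 2"
  by (simp add: energy_def inner_vec_def matrix_vector_mult_def sum_distrib_left sum_distrib_right mult_ac)

lemma energy_nonneg:
  assumes "q \<in> U"
  shows "energy G (q, p) \<ge> 0"
proof (cases "Ginv q *v p = 0")
  case False
  then show ?thesis using pos_G[OF assms, of "Ginv q *v p"] assms by (simp add: energy_eq)
qed (simp add: energy_eq)

lemma differentiable_Ginv: "q \<in> U \<Longrightarrow> Ginv differentiable (at q)"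
  by (intro differentiable_vec_nth differentiable_Ginv_component)

text \<open>With \<open>y\<close> the vector dual to the covector, the minus sign comes from
  differentiating the inverse metric.\<close>

definition dE :: "(real^'n) \<times> (real^'n) \<Rightarrow> (real^'n) \<times> (real^'n) \<Rightarrow> real" where
  "dE z x = (let y = Ginv (fst z) *v snd z in snd x \<bullet> y - ((dG (fst z) (fst x) *v y) \<bullet> y) / 2)"

text \<open>Differentiability of the inverse gives some derivative \<open>D\<close>; differentiating
  \<open>G y = p\<close> then determines \<open>G q *v D x\<close>, so no formula for the derivative
  of the inverse matrix is required.\<close>

lemma has_derivative_Ginv_vec:
  assumes "q \<in> U"
  obtains D where "((\<lambda>z. Ginv (fst z) *v snd z) has_derivative D) (at (q, p))"
    and "\<And>x. G q *v D x = snd x - dG q (fst x) *v (Ginv q *v p)"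
proof -
  obtain D0 where "(Ginv has_derivative D0) (at q)"
    using differentiable_Ginv[OF assms] by (auto simp: differentiable_def)
  then have "((\<lambda>z. Ginv (fst z)) has_derivative (\<lambda>x. D0 (fst x))) (at (q, p))"
    by (intro has_derivative_compose[where f=fst and g=Ginv]) (auto intro!: derivative_eq_intros)
  from bounded_bilinear.FDERIV[OF bounded_bilinear_matrix_vector_mult this has_derivative_snd[OF has_derivative_ident]]
  obtain D where D: "((\<lambda>z. Ginv (fst z) *v snd z) has_derivative D) (at (q, p))" by blast
  have "((\<lambda>z. G (fst z)) has_derivative (\<lambda>x. dG q (fst x))) (at (q, p))"
    by (rule has_derivative_compose[where f=fst and g=G])
       (use has_derivative_G[OF assms] in \<open>auto intro!: derivative_eq_intros\<close>)
  from bounded_bilinear.FDERIV[OF bounded_bilinear_matrix_vector_mult this D]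
  have "((\<lambda>z. G (fst z) *v (Ginv (fst z) *v snd z)) has_derivative
      (\<lambda>x. G q *v D x + dG q (fst x) *v (Ginv q *v p))) (at (q, p))" by simp
  then have "(snd has_derivative (\<lambda>x. G q *v D x + dG q (fst x) *v (Ginv q *v p))) (at (q, p))"
    by (rule has_derivative_transform_within_open[OF _ open_Times[OF open_U open_UNIV]]) (use assms in auto)
  from has_derivative_unique[OF this has_derivative_snd[OF has_derivative_ident]]
  have "G q *v D x + dG q (fst x) *v (Ginv q *v p) = snd x" for x by metis
  then have "G q *v D x = snd x - dG q (fst x) *v (Ginv q *v p)" for x
    by (simp add: eq_diff_eq)
  with D that show ?thesis by blast
qed

lemma has_derivative_energy:
  assumes q: "q \<in> U"
  shows "(energy G has_derivative dE (q, p)) (at (q, p))"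
proof -
  let ?y = "Ginv q *v p"
  obtain D where D: "((\<lambda>z. Ginv (fst z) *v snd z) has_derivative D) (at (q, p))"
    and GD: "\<And>x. G q *v D x = snd x - dG q (fst x) *v ?y"
    using has_derivative_Ginv_vec[OF q, where p=p] by blast
  have "((\<lambda>z. ((Ginv (fst z) *v snd z) \<bullet> snd z) / 2) has_derivative
      (\<lambda>x. (?y \<bullet> snd x + D x \<bullet> p) / 2)) (at (q, p))"
    using has_derivative_divide'[OF has_derivative_inner[OF D has_derivative_snd[OF has_derivative_ident]], of "\<lambda>_. 2"]
    by (auto intro!: derivative_eq_intros D)
  moreover have "(\<lambda>z. ((Ginv (fst z) *v snd z) \<bullet> snd z) / 2) = energy G"
    using energy_eq by (auto simp: fun_eq_iff)
  moreover have "(?y \<bullet> snd x + D x \<bullet> p) / 2 = dE (q, p) x" for x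
  proof -
    have "D x \<bullet> p = D x \<bullet> (G q *v ?y)" using q by simp
    also have "\<dots> = (G q *v D x) \<bullet> ?y"
      using G_symmetric[OF q, of ?y "D x"] by (simp add: inner_commute)
    also have "\<dots> = snd x \<bullet> ?y - (dG q (fst x) *v ?y) \<bullet> ?y"
      by (simp add: GD inner_diff_left)
    finally show ?thesis
      by (simp add: dE_def Let_def inner_commute[of ?y "snd x"] field_simps)
  qed
  ultimately show ?thesis by (simp add: fun_eq_iff[symmetric])
qed

text \<open>On the zero section \<open>f\<close> has only a one-sided derivative. Since the energy
  is nonnegative over \<open>U\<close>, the chain rule within sets applies and still yields a full
  derivative on the bundle.\<close>

lemma has_derivative_fun_energy:
  fixes f :: "real \<Rightarrow> real"
  assumes q: "q \<in> U" and f: "f differentiable_on {0..}"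
  shows "((\<lambda>z. f (energy G z)) has_derivative (\<lambda>x. ddt f (energy G (q, p)) * dE (q, p) x)) (at (q, p))"
proof -
  let ?S = "U \<times> (UNIV :: (real^'n) set)"
  have S: "at (q, p) within ?S = at (q, p)"
    by (rule at_within_open) (use q open_U in \<open>auto intro: open_Times\<close>)
  have "(f has_vector_derivative ddt f (energy G (q, p))) (at (energy G (q, p)) within {0..})"
    by (rule has_vector_derivative_ddt[OF f energy_nonneg[OF q]])
  then have "(f has_derivative (\<lambda>h. h *\<^sub>R ddt f (energy G (q, p)))) (at (energy G (q, p)) within energy G ` ?S)"
    unfolding has_vector_derivative_def
    by (rule has_derivative_subset) (use energy_nonneg in auto)
  moreover have "(energy G has_derivative dE (q, p)) (at (q, p) within ?S)"
    unfolding S by (rule has_derivative_energy[OF q])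
  ultimately have "((\<lambda>z. f (energy G z)) has_derivative (\<lambda>x. dE (q, p) x *\<^sub>R ddt f (energy G (q, p)))) (at (q, p) within ?S)"
    by (rule has_derivative_in_compose[rotated])
  then show ?thesis unfolding S by (simp add: mult.commute)
qed

text \<open>Parallel transport preserves the length of covectors: with \<open>G q *v y = p\<close>
  the two parts of \<open>dE\<close> cancel by metric compatibility.\<close>

lemma dE_horizontal:
  assumes q: "q \<in> U"
  shows "dE (q, p) (u, Gam (q, p) u) = 0"
  using q by (simp add: dE_def Let_def Gam_inner metric_compatible)
    (metis G_Ginv G_symmetric inner_commute)

end

section \<open>Natural structures in a chart\<close>

locale natural_structure = local_metric U G for U :: "(real^'n) set" and G +
  fixes a1 a2 b1 b2 :: "real \<Rightarrow> real"
  assumes differentiable: "a1 differentiable_on {0..}" "a2 differentiable_on {0..}"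
      "b1 differentiable_on {0..}" "b2 differentiable_on {0..}"
    and a_inverse: "t \<ge> 0 \<Longrightarrow> a1 t * a2 t = 1"
    and ab_inverse: "t \<ge> 0 \<Longrightarrow> (a1 t + 2 * t * b1 t) * (a2 t + 2 * t * b2 t) = 1"
begin

text \<open>In the adapted frame, \<open>J\<close> sends the horizontal lift of \<open>u\<close> to the vertical vector \<open>Am u\<close>, and the
  vertical vector \<open>w\<close> to the horizontal lift of \<open>- Bm w\<close>.\<close>

definition Am :: "(real^'n) \<times> (real^'n) \<Rightarrow> real^'n \<Rightarrow> real^'n" where
  "Am z u = a1 (energy G z) *\<^sub>R (G (fst z) *v u) + (b1 (energy G z) * (snd z \<bullet> u)) *\<^sub>R snd z"

definition Bm :: "(real^'n) \<times> (real^'n) \<Rightarrow> real^'n \<Rightarrow> real^'n" where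
  "Bm z w = (let y = Ginv (fst z) *v snd z in
     a2 (energy G z) *\<^sub>R (Ginv (fst z) *v w) + (b2 (energy G z) * (y \<bullet> w)) *\<^sub>R y)"

definition Jn :: "(real^'n) \<times> (real^'n) \<Rightarrow> (real^'n) \<times> (real^'n) \<Rightarrow> (real^'n) \<times> (real^'n)" where
  "Jn z e = (let w = Bm z (snd e - Gam z (fst e)) in (- w, Am z (fst e) - Gam z w))"

lemma inner_sharp: "q \<in> U \<Longrightarrow> (Ginv q *v p) \<bullet> p = 2 * energy G (q, p)"
  by (simp add: energy_eq)

text \<open>The two relations between the coefficients differ by \<open>2t\<close> times this sum,
  which can be divided out when \<open>p\<close> is nonzero. At \<open>p = 0\<close> the rank-one
  parts of \<open>Am\<close> and \<open>Bm\<close> vanish.\<close>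

lemma ab_cross:
  assumes "q \<in> U" "p \<noteq> 0"
  shows "a1 (energy G (q, p)) * b2 (energy G (q, p)) + b1 (energy G (q, p)) * a2 (energy G (q, p))
    + 2 * energy G (q, p) * b1 (energy G (q, p)) * b2 (energy G (q, p)) = 0"
proof -
  let ?t = "energy G (q, p)"
  have "Ginv q *v p \<noteq> 0" using assms by (metis G_Ginv matrix_vector_mult_0_right)
  from pos_G[OF assms(1) this] have "?t > 0" using assms by (simp add: energy_eq)
  moreover have "2 * ?t * (a1 ?t * b2 ?t + b1 ?t * a2 ?t + 2 * ?t * b1 ?t * b2 ?t) = 0"
    using a_inverse[of ?t] ab_inverse[of ?t] \<open>?t > 0\<close> by (simp add: algebra_simps)
  ultimately show ?thesis by simp
qed

lemma Am_Bm:
  assumes q: "q \<in> U"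
  shows "Am (q, p) (Bm (q, p) w) = w"
proof (cases "p = 0")
  case True
  then show ?thesis using q a_inverse[OF energy_nonneg[OF q, of p]]
    by (simp add: Am_def Bm_def Let_def matrix_vector_mult_scaleR)
next
  case False
  let ?t = "energy G (q, p)" and ?y = "Ginv q *v p"
  have "Am (q, p) (Bm (q, p) w) = (a1 ?t * a2 ?t) *\<^sub>R w
      + ((?y \<bullet> w) * (a1 ?t * b2 ?t + b1 ?t * a2 ?t + 2 * ?t * b1 ?t * b2 ?t)) *\<^sub>R p"
    using q Ginv_symmetric[OF q, of w p] inner_sharp[OF q, of p]
    by (simp add: Am_def Bm_def Let_def matrix_vector_mult_scaleR matrix_vector_right_distrib inner_add_right
        inner_commute[of p] algebra_simps flip: scaleR_add_left)
  then show ?thesis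
    using ab_cross[OF q False] a_inverse[OF energy_nonneg[OF q, of p]] by simp
qed

lemma Bm_Am:
  assumes q: "q \<in> U"
  shows "Bm (q, p) (Am (q, p) u) = u"
proof (cases "p = 0")
  case True
  then show ?thesis using q a_inverse[OF energy_nonneg[OF q, of p]]
    by (simp add: Am_def Bm_def Let_def matrix_vector_mult_scaleR mult.commute)
next
  case False
  let ?t = "energy G (q, p)" and ?y = "Ginv q *v p"
  have "?y \<bullet> (G q *v u) = p \<bullet> u"
    using q G_symmetric[OF q, of ?y u] by (simp add: inner_commute)
  then have "Bm (q, p) (Am (q, p) u) = (a1 ?t * a2 ?t) *\<^sub>R u
      + ((p \<bullet> u) * (a1 ?t * b2 ?t + b1 ?t * a2 ?t + 2 * ?t * b1 ?t * b2 ?t)) *\<^sub>R ?y"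
    using q inner_sharp[OF q, of p]
    by (simp add: Am_def Bm_def Let_def matrix_vector_mult_scaleR matrix_vector_right_distrib inner_add_right
        algebra_simps flip: scaleR_add_left)
  then show ?thesis
    using ab_cross[OF q False] a_inverse[OF energy_nonneg[OF q, of p]] by simp
qed

lemma linear_Am: "linear (Am z)"
  by (rule linearI) (simp_all add: Am_def matrix_vector_right_distrib matrix_vector_mult_scaleR inner_add_right algebra_simps)

lemma linear_Bm: "linear (Bm z)"
  by (rule linearI) (simp_all add: Bm_def Let_def matrix_vector_right_distrib matrix_vector_mult_scaleR inner_add_right algebra_simps)

lemma linear_Jn: "linear (Jn z)"
  by (rule linearI) (simp_all add: Jn_def Let_def linear_add[OF linear_Am] linear_add[OF linear_Gam] linear_add[OF linear_Bm]
      linear_diff[OF linear_Bm] linear_diff[OF linear_Gam] linear_cmul[OF linear_Am] linear_cmul[OF linear_Gam] linear_cmul[OF linear_Bm] algebra_simps)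

lemma Jn_Jn:
  assumes "q \<in> U"
  shows "Jn (q, p) (Jn (q, p) e) = - e"
  by (cases e) (simp add: Jn_def Let_def Am_Bm[OF assms] Bm_Am[OF assms] linear_neg[OF linear_Am] linear_neg[OF linear_Gam])

text \<open>\<open>w - Gam (q, p) u\<close> is the vertical part of \<open>(u, w)\<close>, and
  symmetry of the metric and its inverse absorbs the transposed indices in the frame sums. The
  calculations that follow use \<open>Jn\<close>.\<close>

lemma J_chart_eq_Jn:
  assumes q: "q \<in> U"
  shows "J_chart a1 a2 b1 b2 G (q, p) e = Jn (q, p) e"
proof -
  obtain u w where e: "e = (u, w)" by (cases e)
  let ?t = "energy G (q, p)" and ?y = "Ginv q *v p"
  define w' where "w' = w - Gam (q, p) u"
  have g0: "g0 G (q, p) i = ?y $ i" for i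
    by (simp add: g0_def matrix_vector_mult_def sym_Ginv[OF q, of i] mult.commute)
  have w': "w $ h - (\<Sum>i\<in>UNIV. u$i * Gamma0 G (q, p) i h) = w' $ h" for h
    by (simp add: w'_def Gam_def)
  have B: "(\<Sum>h\<in>UNIV. w' $ h * (- a2 ?t * Ginv q $ h $ j - b2 ?t * g0 G (q, p) h * g0 G (q, p) j)) = - Bm (q, p) w' $ j" for j
    by (simp add: Bm_def Let_def g0 matrix_vector_mult_def[of _ w'] inner_vec_def sym_Ginv[OF q, of j]
        sum_distrib_left sum_distrib_right sum_subtractf sum_negf algebra_simps)
  have horiz: "(\<Sum>j\<in>UNIV. c j *\<^sub>R horiz G (q, p) j) = ((\<chi> j. c j), Gam (q, p) (\<chi> j. c j))" for c
    by (simp add: horiz_def vec_eq_iff prod_eq_iff fst_sum snd_sum Gam_def axis_def if_distrib cong: if_cong)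
  have vert: "(\<Sum>j\<in>UNIV. c j *\<^sub>R vert j) = (0, (\<chi> j. c j))" for c :: "'n \<Rightarrow> real"
    by (simp add: vert_def vec_eq_iff prod_eq_iff fst_sum snd_sum axis_def if_distrib cong: if_cong)
  have "(\<Sum>h\<in>UNIV. (w' $ h) *\<^sub>R J_vert a2 b2 G (q, p) h)
      = (\<Sum>j\<in>UNIV. (\<Sum>h\<in>UNIV. w' $ h * (- a2 ?t * Ginv q $ h $ j - b2 ?t * g0 G (q, p) h * g0 G (q, p) j)) *\<^sub>R horiz G (q, p) j)"
    by (simp only: J_vert_def Let_def prod.case scaleR_sum_right scaleR_sum_left scaleR_scaleR) (rule sum.swap)
  also have "\<dots> = (- Bm (q, p) w', - Gam (q, p) (Bm (q, p) w'))"
  proof -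
    have "(\<chi> j. - Bm (q, p) w' $ j) = - Bm (q, p) w'" by (simp add: vec_eq_iff)
    then show ?thesis unfolding B horiz by (simp add: linear_neg[OF linear_Gam])
  qed
  finally have 1: "(\<Sum>h\<in>UNIV. (w' $ h) *\<^sub>R J_vert a2 b2 G (q, p) h) = (- Bm (q, p) w', - Gam (q, p) (Bm (q, p) w'))" .
  have "(\<Sum>i\<in>UNIV. (u $ i) *\<^sub>R J_horiz a1 b1 G (q, p) i)
      = (\<Sum>j\<in>UNIV. (\<Sum>i\<in>UNIV. u $ i * (a1 ?t * G q $ i $ j + b1 ?t * p$i * p$j)) *\<^sub>R vert j)"
    by (simp only: J_horiz_def Let_def prod.case scaleR_sum_right scaleR_sum_left scaleR_scaleR) (rule sum.swap)
  also have "\<dots> = (0, Am (q, p) u)"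
    unfolding vert
    by (simp add: Am_def vec_eq_iff matrix_vector_mult_def inner_vec_def sym_G[OF q, of _ i for i]
        sum_distrib_left sum_distrib_right sum.distrib algebra_simps)
  finally have 2: "(\<Sum>i\<in>UNIV. (u $ i) *\<^sub>R J_horiz a1 b1 G (q, p) i) = (0, Am (q, p) u)" .
  show ?thesis
    unfolding e J_chart_def prod.case w' 1 2 by (simp add: Jn_def Let_def w'_def)
qed

section \<open>Differentiability of the structure in a chart\<close>

lemma has_derivative_G_fst:
  assumes "q \<in> U"
  shows "((\<lambda>z. G (fst z) *v u) has_derivative (\<lambda>x. dG q (fst x) *v u)) (at (q, p))"
proof -
  have "((\<lambda>z. G (fst z)) has_derivative (\<lambda>x. dG q (fst x))) (at (q, p))"
    by (rule has_derivative_compose[where f=fst and g=G])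
       (use has_derivative_G[OF assms] in \<open>auto intro!: derivative_eq_intros\<close>)
  from bounded_bilinear.FDERIV[OF bounded_bilinear_matrix_vector_mult this has_derivative_const]
  show ?thesis by simp
qed

lemma has_derivative_Am:
  assumes q: "q \<in> U"
  shows "((\<lambda>z. Am z u) has_derivative (\<lambda>x.
     (ddt a1 (energy G (q, p)) * dE (q, p) x) *\<^sub>R (G q *v u) + a1 (energy G (q, p)) *\<^sub>R (dG q (fst x) *v u)
     + (ddt b1 (energy G (q, p)) * dE (q, p) x * (p \<bullet> u) + b1 (energy G (q, p)) * (snd x \<bullet> u)) *\<^sub>R p
     + (b1 (energy G (q, p)) * (p \<bullet> u)) *\<^sub>R snd x)) (at (q, p))"
  unfolding Am_def
  by (rule has_derivative_eq_rhs,
      (rule has_derivative_add has_derivative_scaleR has_derivative_mult has_derivative_G_fst[OF q]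
        has_derivative_fun_energy[OF q differentiable(1)] has_derivative_fun_energy[OF q differentiable(3)]
        has_derivative_inner_left has_derivative_snd has_derivative_ident)+)
     (simp add: fun_eq_iff algebra_simps)

lemma differentiable_Bm:
  assumes q: "q \<in> U"
  shows "(\<lambda>z. Bm z w) differentiable (at (q, p))"
proof -
  have f: "(\<lambda>z. f (energy G z)) differentiable (at (q, p))" if "f differentiable_on {0..}" for f :: "real \<Rightarrow> real"
    using has_derivative_fun_energy[OF q that] by (rule differentiableI)
  have y: "(\<lambda>z. Ginv (fst z) *v snd z) differentiable (at (q, p))"
    using has_derivative_Ginv_vec[OF q, where p=p] differentiableI by blast
  have "(\<lambda>z. Ginv (fst z) *v w) differentiable (at (q, p))"
  proof -
    obtain D0 where "(Ginv has_derivative D0) (at q)"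
      using differentiable_Ginv[OF q] by (auto simp: differentiable_def)
    then have "((\<lambda>z. Ginv (fst z)) has_derivative (\<lambda>x. D0 (fst x))) (at (q, p))"
      by (intro has_derivative_compose[where f=fst and g=Ginv]) (auto intro!: derivative_eq_intros)
    from bounded_bilinear.FDERIV[OF bounded_bilinear_matrix_vector_mult this has_derivative_const]
    show ?thesis by (rule differentiableI)
  qed
  then show ?thesis
    unfolding Bm_def Let_def
    by (intro differentiable_add differentiable_scaleR differentiable_mult differentiable_inner f y differentiable differentiable_const)
qed

lemma differentiable_Gam:
  assumes q: "q \<in> U"
  shows "(\<lambda>z. Gam z u) differentiable (at (q, p))"
  using has_derivative_Gam[OF q] by (rule differentiableI)

lemma differentiable_Jn:
  assumes q: "q \<in> U"
  shows "(\<lambda>z. Jn z e) differentiable (at (q, p))"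
proof -
  have "(\<lambda>z. Bm z (snd e - Gam z (fst e))) differentiable (at (q, p))"
    by (rule differentiable_linear_family[OF linear_Bm differentiable_Bm[OF q]
          differentiable_diff[OF differentiable_const differentiable_Gam[OF q]]])
  moreover from this have "(\<lambda>z. Gam z (Bm z (snd e - Gam z (fst e)))) differentiable (at (q, p))"
    by (rule differentiable_linear_family[OF linear_Gam differentiable_Gam[OF q]])
  moreover have "(\<lambda>z. Am z (fst e)) differentiable (at (q, p))"
    using has_derivative_Am[OF q] by (rule differentiableI)
  ultimately show ?thesis
    unfolding Jn_def Let_def by (intro differentiable_Pair differentiable_minus differentiable_diff)
qed

sublocale almost_complex "U \<times> UNIV" Jn
proof (rule almost_complex.intro)
  show "open (U \<times> (UNIV :: (real^'n) set))" by (intro open_Times open_U open_UNIV)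
qed (auto simp: Jn_Jn intro: differentiable_Jn linear_Jn)

section \<open>The torsion on horizontal lifts\<close>

definition hlift :: "real^'n \<Rightarrow> (real^'n) \<times> (real^'n) \<Rightarrow> (real^'n) \<times> (real^'n)" where
  "hlift u z = (u, Gam z u)"

lemma Jn_hlift: "Jn z (hlift u z) = (0, Am z u)"
  by (simp add: hlift_def Jn_def Let_def linear_0[OF linear_Bm] linear_0[OF linear_Gam])

text \<open>Since \<open>Am\<close> inverts \<open>Bm\<close>, a vertical vector \<open>w\<close> is
  the image under \<open>Jn\<close> of the horizontal lift of \<open>Bm (q, p) w\<close>.\<close>

lemma hlift_Jn_generate:
  assumes "q \<in> U"
  shows "\<exists>u v. e = hlift u (q, p) + Jn (q, p) (hlift v (q, p))"
proof (intro exI)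
  show "e = hlift (fst e) (q, p) + Jn (q, p) (hlift (Bm (q, p) (snd e - Gam (q, p) (fst e))) (q, p))"
    unfolding Jn_hlift Am_Bm[OF assms] by (simp add: hlift_def prod_eq_iff)
qed

text \<open>The function \<open>F\<close>. The factor \<open>a1 + 2tb1\<close> is the rate at which
  \<open>t\<close> changes along the vertical vector \<open>Am z u\<close>, per unit of
  \<open>p(u)\<close>; \<open>- a1 b1\<close> comes from differentiating the quadratic factor in
  \<open>p\<close> that multiplies \<open>b1\<close>.\<close>

definition curvature_factor :: "real \<Rightarrow> real" where
  "curvature_factor t = (a1 t + 2 * t * b1 t) * ddt a1 t - a1 t * b1 t"

lemma torsion_hlift:
  fixes p u v :: "real^'n"
  assumes q: "q \<in> U"
  defines "T \<equiv> torsion (q, p) (hlift u (q, p)) (hlift v (q, p))"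
  shows "fst T = 0" and "snd T \<bullet> w = curvature_factor (energy G (q, p)) * ((p \<bullet> u) * ((G q *v v) \<bullet> w) - (p \<bullet> v) * ((G q *v u) \<bullet> w))
      - p \<bullet> Riem q u v w"
proof -
  let ?z = "(q, p)" and ?t = "energy G (q, p)"
  define dA where "dA u x = (ddt a1 ?t * dE (q, p) x) *\<^sub>R (G q *v u) + a1 ?t *\<^sub>R (dG q (fst x) *v u)
     + (ddt b1 ?t * dE (q, p) x * (p \<bullet> u) + b1 ?t * (snd x \<bullet> u)) *\<^sub>R p + (b1 ?t * (p \<bullet> u)) *\<^sub>R snd x" for u x
  have H: "(hlift u has_derivative (\<lambda>x. (0, dGam ?z x u))) (at ?z)" for u
    using has_derivative_Pair[OF has_derivative_const has_derivative_Gam[OF q], of u u p]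
    unfolding hlift_def[abs_def] .
  have JH: "((\<lambda>z. (0 :: real^'n, Am z u)) has_derivative (\<lambda>x. (0, dA u x))) (at ?z)" for u
    unfolding dA_def by (rule has_derivative_Pair[OF has_derivative_const has_derivative_Am[OF q]])
  note fd = frechet_derivative_at[OF H, symmetric] frechet_derivative_at[OF JH, symmetric]
  have E: "dE ?z (u, Gam ?z u) = 0" for u
    by (rule dE_horizontal[OF q])
  have Am_inner: "Am ?z v \<bullet> w = a1 ?t * ((G q *v v) \<bullet> w) + b1 ?t * (p \<bullet> v) * (p \<bullet> w)" for v w
    by (simp add: Am_def inner_add_left)
  \<comment> \<open>\<open>?m\<close> is the vertical part of
    \<open>[J \<delta>_u, \<delta>_v] + [\<delta>_u, J \<delta>_v]\<close>. The derivatives of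
    \<open>a1\<close> and \<open>b1\<close> drop out by \<open>E\<close>; the connection terms
    cancel by metric compatibility and symmetry of \<open>Chr\<close>.\<close>
  have mixed: "(dGam ?z (0, Am ?z u) v - dA u (hlift v ?z)) + (dA v (hlift u ?z) - dGam ?z (0, Am ?z v) u) = 0" (is "?m = 0")
  proof -
    have "?m \<bullet> w = 0" for w
      using Chr_commute[OF q, of u v] G_symmetric[OF q, of u "Chr q v w"] G_symmetric[OF q, of v "Chr q u w"]
      by (simp add: inner_add_left inner_diff_left dGam_inner dA_def hlift_def E Am_inner Gam_inner
          metric_compatible[OF q] inner_commute[of _ p] dChr_zero[OF q] algebra_simps)
    then show ?thesis by (metis inner_eq_zero_iff)
  qed
  have T: "T = (0, dA v (0, Am ?z u) - dA u (0, Am ?z v)) - (0, dGam ?z (hlift u ?z) v - dGam ?z (hlift v ?z) u)"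
  proof -
    \<comment> \<open>Linearity collects both mixed brackets under a single \<open>Jn\<close>, where
      they cancel each other.\<close>
    have "T = bracket (\<lambda>z. Jn z (hlift u z)) (\<lambda>z. Jn z (hlift v z)) ?z
        - Jn ?z (bracket (\<lambda>z. Jn z (hlift u z)) (hlift v) ?z + bracket (hlift u) (\<lambda>z. Jn z (hlift v z)) ?z)
        - bracket (hlift u) (hlift v) ?z"
      unfolding T_def linear_add[OF linear_Jn]
      using nijenhuis_eq_torsion[of ?z "hlift u" "hlift v", OF _ differentiableI[OF H] differentiableI[OF H]] q
      by (simp add: algebra_simps)
    moreover have "bracket (\<lambda>z. Jn z (hlift u z)) (hlift v) ?z + bracket (hlift u) (\<lambda>z. Jn z (hlift v z)) ?z = (0, ?m)"
      unfolding bracket_def fd Jn_hlift by simp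
    ultimately show ?thesis
      unfolding mixed by (simp add: bracket_def fd Jn_hlift linear_0[OF linear_Jn] flip: zero_prod_def)
  qed
  then show "fst T = 0" by simp
  let ?y = "Ginv q *v p"
  have yG: "?y \<bullet> (G q *v u) = p \<bullet> u" for u
    using q G_symmetric[OF q, of ?y u] by (simp add: inner_commute)
  have dE_vert: "dE ?z (0, Am ?z u) = (a1 ?t + 2 * ?t * b1 ?t) * (p \<bullet> u)" for u
    using yG[of u] inner_sharp[OF q, of p]
    by (simp add: dE_def Let_def Am_inner inner_commute[of _ ?y] linear_0[OF has_derivative_linear[OF has_derivative_G[OF q]]] algebra_simps)
  \<comment> \<open>The terms with the derivative of \<open>b1\<close> and those with
    \<open>Am ?z u \<bullet> v\<close> are symmetric in \<open>u\<close> and \<open>v\<close>, so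
    they disappear in the difference.\<close>
  have "(dA v (0, Am ?z u) - dA u (0, Am ?z v)) \<bullet> w
      = curvature_factor ?t * ((p \<bullet> u) * ((G q *v v) \<bullet> w) - (p \<bullet> v) * ((G q *v u) \<bullet> w))"
    using G_symmetric[OF q, of u v]
    by (simp add: dA_def curvature_factor_def dE_vert Am_inner inner_add_left inner_diff_left
        linear_0[OF has_derivative_linear[OF has_derivative_G[OF q]]] algebra_simps)
  \<comment> \<open>The bracket of two horizontal lifts is vertical and measures the curvature of
    the horizontal distribution.\<close>
  moreover have "(dGam ?z (hlift u ?z) v - dGam ?z (hlift v ?z) u) \<bullet> w = p \<bullet> Riem q u v w"
    by (simp add: inner_diff_left dGam_inner hlift_def Gam_inner Riem_def inner_add_right inner_diff_right)
  ultimately show "snd T \<bullet> w = curvature_factor ?t * ((p \<bullet> u) * ((G q *v v) \<bullet> w) - (p \<bullet> v) * ((G q *v u) \<bullet> w)) - p \<bullet> Riem q u v w"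
    unfolding T by (simp add: inner_diff_left)
qed

lemma torsion_eq_0_iff:
  assumes q: "q \<in> U"
  shows "(\<forall>e f. torsion (q, p) e f = 0) \<longleftrightarrow>
    (\<forall>u v w. p \<bullet> Riem q u v w = curvature_factor (energy G (q, p)) * ((p \<bullet> u) * ((G q *v v) \<bullet> w) - (p \<bullet> v) * ((G q *v u) \<bullet> w)))"
proof
  assume T: "\<forall>e f. torsion (q, p) e f = 0"
  show "\<forall>u v w. p \<bullet> Riem q u v w = curvature_factor (energy G (q, p)) * ((p \<bullet> u) * ((G q *v v) \<bullet> w) - (p \<bullet> v) * ((G q *v u) \<bullet> w))"
  proof (intro allI)
    fix u v w
    have "torsion (q, p) (hlift u (q, p)) (hlift v (q, p)) = 0" using T by blast
    then show "p \<bullet> Riem q u v w = curvature_factor (energy G (q, p)) * ((p \<bullet> u) * ((G q *v v) \<bullet> w) - (p \<bullet> v) * ((G q *v u) \<bullet> w))"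
      using torsion_hlift(2)[OF q, of p u v w] by simp
  qed
next
  assume R: "\<forall>u v w. p \<bullet> Riem q u v w = curvature_factor (energy G (q, p)) * ((p \<bullet> u) * ((G q *v v) \<bullet> w) - (p \<bullet> v) * ((G q *v u) \<bullet> w))"
  have "torsion (q, p) (hlift u (q, p)) (hlift v (q, p)) = 0" for u v
  proof -
    have "snd (torsion (q, p) (hlift u (q, p)) (hlift v (q, p))) \<bullet> w = 0" for w
      using torsion_hlift(2)[OF q, of p u v w] R by simp
    then have "snd (torsion (q, p) (hlift u (q, p)) (hlift v (q, p))) = 0" by (metis inner_eq_zero_iff)
    then show ?thesis using torsion_hlift(1)[OF q] by (simp add: prod_eq_iff)
  qed
  then show "\<forall>e f. torsion (q, p) e f = 0"
    using torsion_eq_0_if_generating[of "(q, p)" "\<lambda>u. hlift u (q, p)"] hlift_Jn_generate[OF q] q by blast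
qed

end

section \<open>Integrability\<close>

lemma metric_coeff_nth:
  assumes "smooth_manifold A" "m \<in> chart_dom A \<alpha>"
  shows "metric_coeff A g \<alpha> (chart_map A \<alpha> m) $ i $ j
    = g m (coord_vector A \<alpha> m (axis i 1)) (coord_vector A \<alpha> m (axis j 1))"
proof -
  interpret smooth_atlas A using assms(1) by (rule smooth_manifold_imp_smooth_atlas)
  show ?thesis using assms(2) by (simp add: metric_coeff_def Let_def)
qed

lemma local_metric_chart:
  fixes A :: "('i, 'm, real^'n) atlas"
  assumes A: "smooth_manifold A" and g: "riemannian_metric A g"
  shows "local_metric (chart_img A \<alpha>) (metric_coeff A g \<alpha>)"
proof -
  interpret smooth_atlas A using A by (rule smooth_manifold_imp_smooth_atlas)
  show ?thesis
  proof
    show "open (chart_img A \<alpha>)" by (rule open_chart_img)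
    show "smooth_on (chart_img A \<alpha>) (\<lambda>q. metric_coeff A g \<alpha> q $ i $ j)" for i j
      using g by (simp add: riemannian_metric_def)
  next
    fix q assume "q \<in> chart_img A \<alpha>"
    then obtain m where m: "m \<in> chart_dom A \<alpha>" and q: "q = chart_map A \<alpha> m" by (auto simp: chart_img_def)
    have mp: "m \<in> points A" using m by (auto simp: points_def)
    note g_linear = g[unfolded riemannian_metric_def, THEN conjunct1, rule_format, OF mp]
    note c = coord_vector_in_tangent_space[OF m]
    show sym: "metric_coeff A g \<alpha> q $ i $ j = metric_coeff A g \<alpha> q $ j $ i" for i j
      unfolding q metric_coeff_nth[OF A m] using g_linear c by blast
    fix v :: "real^'n" assume v: "v \<noteq> 0"
    let ?e = "\<lambda>v. coord_vector A \<alpha> m v"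
    have lin: "linear (\<lambda>x. g m (?e y) (?e x))" for y
      using g_linear c by (intro linear_form_coord_vector[OF m]) blast
    have "g m (?e v) (?e v) = (\<Sum>i\<in>UNIV. v$i * g m (?e v) (?e (axis i 1)))"
      using linear_axis_expansion[OF lin, of v v] by simp
    \<comment> \<open>Linearity is given in the second argument of the metric; symmetry moves the
      unexpanded vector there before the next expansion.\<close>
    also have "\<dots> = (\<Sum>i\<in>UNIV. v$i * g m (?e (axis i 1)) (?e v))"
      using g_linear c by (metis (no_types, lifting))
    also have "\<dots> = (\<Sum>i\<in>UNIV. v$i * (\<Sum>j\<in>UNIV. v$j * g m (?e (axis i 1)) (?e (axis j 1))))"
      using linear_axis_expansion[OF lin, of _ v] by simp
    also have "\<dots> = v \<bullet> (metric_coeff A g \<alpha> q *v v)"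
      by (simp add: q inner_vec_def matrix_vector_mult_def metric_coeff_nth[OF A m] mult.commute)
    finally have "v \<bullet> (metric_coeff A g \<alpha> q *v v) = g m (?e v) (?e v)" ..
    moreover have "?e v \<noteq> (\<lambda>\<alpha>. 0)"
      using coord_vector_same[OF m, of v] v by auto
    ultimately show "v \<bullet> (metric_coeff A g \<alpha> q *v v) > 0"
      using g_linear c by simp
  qed
qed

lemma constant_sectional_curvature_chart:
  fixes A :: "('i, 'm, real^'n) atlas"
  assumes A: "smooth_manifold A" and g: "riemannian_metric A g"
  shows "constant_sectional_curvature A g c \<longleftrightarrow> (\<forall>\<alpha>. \<forall>q\<in>chart_img A \<alpha>. \<forall>u v w.
    local_metric.Riem (metric_coeff A g \<alpha>) q u v w
      = c *\<^sub>R (((metric_coeff A g \<alpha> q *v v) \<bullet> w) *\<^sub>R u - ((metric_coeff A g \<alpha> q *v u) \<bullet> w) *\<^sub>R v))"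
proof -
  interpret smooth_atlas A using A by (rule smooth_manifold_imp_smooth_atlas)
  have "constant_sectional_curvature A g c \<longleftrightarrow> (\<forall>\<alpha>. \<forall>q\<in>chart_img A \<alpha>. \<forall>u v.
    u \<noteq> v \<and> independent {u, v} \<longrightarrow> sectional_curvature (metric_coeff A g \<alpha>) q u v = c)" (is "?L \<longleftrightarrow> ?R")
  proof
    assume L: ?L
    show ?R
    proof (intro allI ballI impI)
      fix \<alpha> q and u v :: "real^'n" assume "q \<in> chart_img A \<alpha>" and uv: "u \<noteq> v \<and> independent {u, v}"
      then obtain m where m: "m \<in> chart_dom A \<alpha>" and q: "q = chart_map A \<alpha> m" by (auto simp: chart_img_def)
      show "sectional_curvature (metric_coeff A g \<alpha>) q u v = c"
        using L[unfolded constant_sectional_curvature_def, rule_format, OF m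
            coord_vector_in_tangent_space[OF m, of u] coord_vector_in_tangent_space[OF m, of v]] uv
        by (simp add: coord_vector_same[OF m] q)
    qed
  next
    assume ?R
    then show ?L
      unfolding constant_sectional_curvature_def chart_img_def by blast
  qed
  then show ?thesis
    using local_metric.constant_sectional_curvature_iff[OF local_metric_chart[OF A g]] by simp
qed

lemma integrable_structure_chart:
  fixes A :: "('i, 'm, real^'n) atlas"
  assumes A: "smooth_manifold A" and g: "riemannian_metric A g"
    and nat: "\<And>\<alpha>. natural_structure (chart_img A \<alpha>) (metric_coeff A g \<alpha>) a1 a2 b1 b2"
  shows "integrable_structure (cotangent_bundle A) (natural_J A g a1 a2 b1 b2) \<longleftrightarrow>
    (\<forall>\<alpha>. \<forall>q\<in>chart_img A \<alpha>. \<forall>p u v w.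
      p \<bullet> local_metric.Riem (metric_coeff A g \<alpha>) q u v w
        = natural_structure.curvature_factor a1 b1 (energy (metric_coeff A g \<alpha>) (q, p))
          * ((p \<bullet> u) * ((metric_coeff A g \<alpha> q *v v) \<bullet> w) - (p \<bullet> v) * ((metric_coeff A g \<alpha> q *v u) \<bullet> w)))"
proof -
  interpret smooth_atlas_vec A
    unfolding smooth_atlas_vec_def using A by (rule smooth_manifold_imp_smooth_atlas)
  let ?B = "cotangent_bundle A" and ?J = "natural_J A g a1 a2 b1 b2"
  interpret B: smooth_atlas ?B by (rule smooth_atlas_cotangent_bundle)
  define Jc where "Jc \<alpha> = natural_structure.Jn (metric_coeff A g \<alpha>) a1 a2 b1 b2" for \<alpha>
  define T where "T \<alpha> = almost_complex.torsion (Jc \<alpha>)" for \<alpha>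
  have img: "chart_img ?B \<alpha> = chart_img A \<alpha> \<times> UNIV" for \<alpha>
    using cotangent_overlap[of \<alpha> \<alpha>] by (simp add: chart_img_def)
  have J: "?J P v \<alpha> = Jc \<alpha> (chart_map ?B \<alpha> P) (v \<alpha>)" if "P \<in> chart_dom ?B \<alpha>" for P v \<alpha>
  proof -
    obtain q p where qp: "chart_map ?B \<alpha> P = (q, p)" by fastforce
    then have "q \<in> chart_img A \<alpha>" using img that by (force simp: chart_img_def)
    then show ?thesis
      using that natural_structure.J_chart_eq_Jn[OF nat] by (simp add: natural_J_def qp Jc_def)
  qed
  have br: "lie_bracket ?B X Y P \<alpha> = bracket (\<lambda>z. X (chart_inv ?B \<alpha> z) \<alpha>) (\<lambda>z. Y (chart_inv ?B \<alpha> z) \<alpha>) (chart_map ?B \<alpha> P)"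
    if "P \<in> chart_dom ?B \<alpha>" for X Y P \<alpha>
    using that by (simp add: lie_bracket_def bracket_def)
  \<comment> \<open>\<open>natural_J\<close> agrees with its chart form only over the chart domain,
    so the fields to be exchanged agree only on the chart image.\<close>
  have JX: "bracket X' Y' (chart_map ?B \<alpha> P) = bracket X Y (chart_map ?B \<alpha> P)"
    if "P \<in> chart_dom ?B \<alpha>" "\<And>z. z \<in> chart_img ?B \<alpha> \<Longrightarrow> X' z = X z" "\<And>z. z \<in> chart_img ?B \<alpha> \<Longrightarrow> Y' z = Y z" for X Y X' Y' P \<alpha>
  proof -
    have "chart_map ?B \<alpha> P \<in> chart_img ?B \<alpha>" using that(1) by (simp add: chart_img_def)
    then show ?thesis
      unfolding bracket_def
      using frechet_derivative_cong_open[OF B.open_chart_img, of _ \<alpha> X' X] frechet_derivative_cong_open[OF B.open_chart_img, of _ \<alpha> Y' Y] that by simp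
  qed
  have nij: "nijenhuis ?B ?J X Y P \<alpha> = T \<alpha> (chart_map ?B \<alpha> P) (X P \<alpha>) (Y P \<alpha>)"
    if P: "P \<in> chart_dom ?B \<alpha>" and X: "(\<lambda>z. X (chart_inv ?B \<alpha> z) \<alpha>) differentiable (at (chart_map ?B \<alpha> P))"
      and Y: "(\<lambda>z. Y (chart_inv ?B \<alpha> z) \<alpha>) differentiable (at (chart_map ?B \<alpha> P))" for X Y P \<alpha>
  proof -
    interpret L: natural_structure "chart_img A \<alpha>" "metric_coeff A g \<alpha>" a1 a2 b1 b2 by (rule nat)
    let ?X = "\<lambda>z. X (chart_inv ?B \<alpha> z) \<alpha>" and ?Y = "\<lambda>z. Y (chart_inv ?B \<alpha> z) \<alpha>" and ?z = "chart_map ?B \<alpha> P"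
    have z: "?z \<in> chart_img A \<alpha> \<times> UNIV" using P img by (auto simp: chart_img_def)
    have JZ: "?J (chart_inv ?B \<alpha> z) (Z (chart_inv ?B \<alpha> z)) \<alpha> = Jc \<alpha> z (Z (chart_inv ?B \<alpha> z) \<alpha>)"
      if "z \<in> chart_img ?B \<alpha>" for z Z
      using that J by (auto simp: chart_img_def)
    have "nijenhuis ?B ?J X Y P \<alpha> = bracket (\<lambda>z. Jc \<alpha> z (?X z)) (\<lambda>z. Jc \<alpha> z (?Y z)) ?z
        - Jc \<alpha> ?z (bracket (\<lambda>z. Jc \<alpha> z (?X z)) ?Y ?z) - Jc \<alpha> ?z (bracket ?X (\<lambda>z. Jc \<alpha> z (?Y z)) ?z) - bracket ?X ?Y ?z"
      unfolding nijenhuis_def Let_def J[OF P] br[OF P]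
      by (intro arg_cong2[where f="(-)"] arg_cong[where f="Jc \<alpha> ?z"] JX[OF P] JZ refl)
    also have "\<dots> = T \<alpha> ?z (?X ?z) (?Y ?z)"
      unfolding T_def Jc_def by (rule L.nijenhuis_eq_torsion[OF z X Y])
    finally show ?thesis using P by simp
  qed
  have "integrable_structure ?B ?J \<longleftrightarrow> (\<forall>\<alpha>. \<forall>q\<in>chart_img A \<alpha>. \<forall>p e f. T \<alpha> (q, p) e f = 0)"
  proof
    assume int: "integrable_structure ?B ?J"
    show "\<forall>\<alpha>. \<forall>q\<in>chart_img A \<alpha>. \<forall>p e f. T \<alpha> (q, p) e f = 0"
    proof (intro allI ballI)
      fix \<alpha> q p e f assume "q \<in> chart_img A \<alpha>"
      then have "(q, p) \<in> chart_img ?B \<alpha>" using img by simp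
      then obtain P where P: "P \<in> chart_dom ?B \<alpha>" and qp: "(q, p) = chart_map ?B \<alpha> P" by (auto simp: chart_img_def)
      \<comment> \<open>Fields with constant components attain any two prescribed vectors at
        \<open>P\<close>, and in the chart \<alpha> they are differentiable as constants.\<close>
      let ?X = "\<lambda>e P. coord_vector ?B \<alpha> P e"
      have "nijenhuis ?B ?J (?X e) (?X f) P = (\<lambda>\<alpha>. 0)"
        using int B.openin_chart_dom B.vector_field_on_coord_vector P unfolding integrable_structure_def by blast
      moreover have "(\<lambda>z. ?X e (chart_inv ?B \<alpha> z) \<alpha>) differentiable (at (chart_map ?B \<alpha> P))" for e
        by (rule differentiable_transform_open[of "\<lambda>_. e", OF _ B.open_chart_img[of \<alpha>]])
           (use P in \<open>auto simp: chart_img_def B.coord_vector_same\<close>)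
      ultimately show "T \<alpha> (q, p) e f = 0"
        using nij[OF P, of "?X e" "?X f"] by (simp add: qp B.coord_vector_same[OF P])
    qed
  next
    assume T: "\<forall>\<alpha>. \<forall>q\<in>chart_img A \<alpha>. \<forall>p e f. T \<alpha> (q, p) e f = 0"
    show "integrable_structure ?B ?J"
      unfolding integrable_structure_def
    proof (intro allI impI ballI ext)
      fix W X Y P \<alpha>
      assume W: "openin (atlas_topology ?B) W \<and> vector_field_on ?B W X \<and> vector_field_on ?B W Y" and "P \<in> W"
      show "nijenhuis ?B ?J X Y P \<alpha> = 0"
      proof (cases "P \<in> chart_dom ?B \<alpha>")
        case True
        have "open (chart_map ?B \<alpha> ` (W \<inter> chart_dom ?B \<alpha>))"
          using W by (simp add: B.openin_atlas_topology)
        then have "(\<lambda>z. X (chart_inv ?B \<alpha> z) \<alpha>) differentiable (at (chart_map ?B \<alpha> P))"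
          if "vector_field_on ?B W X" for X
          using that True \<open>P \<in> W\<close> smooth_onD_has_derivative differentiableI
          unfolding vector_field_on_def by blast
        moreover obtain q p where qp: "chart_map ?B \<alpha> P = (q, p)" by fastforce
        moreover have "q \<in> chart_img A \<alpha>" using qp img True by (force simp: chart_img_def)
        ultimately show ?thesis using nij[OF True, of X Y] W T by simp
      next
        case False
        \<comment> \<open>At the index of a chart that does not contain \<open>P\<close>, brackets
          and \<open>natural_J\<close> take their default value 0.\<close>
        then show ?thesis by (simp add: nijenhuis_def Let_def lie_bracket_def natural_J_def)
      qed
    qed
  qed
  also have "\<dots> \<longleftrightarrow> (\<forall>\<alpha>. \<forall>q\<in>chart_img A \<alpha>. \<forall>p u v w.
      p \<bullet> local_metric.Riem (metric_coeff A g \<alpha>) q u v w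
        = natural_structure.curvature_factor a1 b1 (energy (metric_coeff A g \<alpha>) (q, p))
          * ((p \<bullet> u) * ((metric_coeff A g \<alpha> q *v v) \<bullet> w) - (p \<bullet> v) * ((metric_coeff A g \<alpha> q *v u) \<bullet> w)))"
    unfolding T_def Jc_def using natural_structure.torsion_eq_0_iff[OF nat] by simp
  finally show ?thesis .
qed

theorem theorem3:
  fixes A :: "('i, 'm, real^'n) atlas"
    and g :: "'m \<Rightarrow> ('i \<Rightarrow> real^'n) \<Rightarrow> ('i \<Rightarrow> real^'n) \<Rightarrow> real"
    and a1 a2 b1 b2 :: "real \<Rightarrow> real"
  assumes "smooth_manifold A"
    and "riemannian_metric A g"
    and "CARD('n) > 1"
    and "smooth_on {0..} a1" and "smooth_on {0..} a2"
    and "smooth_on {0..} b1" and "smooth_on {0..} b2"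
    and "\<And>t. t \<ge> 0 \<Longrightarrow> a1 t * a2 t = 1"
    and "\<And>t. t \<ge> 0 \<Longrightarrow> (a1 t + 2 * t * b1 t) * (a2 t + 2 * t * b2 t) = 1"
    and "\<And>t. t \<ge> 0 \<Longrightarrow> a1 t > 0"
    and "\<And>t. t \<ge> 0 \<Longrightarrow> a2 t > 0"
    and "\<And>t. t \<ge> 0 \<Longrightarrow> a1 t + 2 * t * b1 t > 0"
    and "\<And>t. t \<ge> 0 \<Longrightarrow> a2 t + 2 * t * b2 t > 0"
  shows "integrable_structure (cotangent_bundle A) (natural_J A g a1 a2 b1 b2) \<longleftrightarrow>
    (\<exists>c. constant_sectional_curvature A g c \<and>
         (\<forall>t\<ge>0. a1 t - 2 * t * ddt a1 t \<noteq> 0 \<and>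
                b1 t = (a1 t * ddt a1 t - c) / (a1 t - 2 * t * ddt a1 t)))"
proof -
  note A = assms(1) and g = assms(2)
  have nat: "natural_structure (chart_img A \<alpha>) (metric_coeff A g \<alpha>) a1 a2 b1 b2" for \<alpha>
    using assms smooth_on_halfline_differentiable
    by (intro natural_structure.intro natural_structure_axioms.intro local_metric_chart) auto
  have F_def: "natural_structure.curvature_factor a1 b1 t = (a1 t + 2 * t * b1 t) * ddt a1 t - a1 t * b1 t" for t
    by (rule natural_structure.curvature_factor_def[OF nat])
  have F_iff: "natural_structure.curvature_factor a1 b1 t = c \<longleftrightarrow> b1 t * (a1 t - 2 * t * ddt a1 t) = a1 t * ddt a1 t - c" for t c
    unfolding F_def by (auto simp: algebra_simps)
  show ?thesis
  proof
    assume "\<exists>c. constant_sectional_curvature A g c \<and>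
         (\<forall>t\<ge>0. a1 t - 2 * t * ddt a1 t \<noteq> 0 \<and>
                b1 t = (a1 t * ddt a1 t - c) / (a1 t - 2 * t * ddt a1 t))"
    then obtain c where c: "constant_sectional_curvature A g c"
      and b: "\<And>t. t \<ge> 0 \<Longrightarrow> a1 t - 2 * t * ddt a1 t \<noteq> 0 \<and>
                b1 t = (a1 t * ddt a1 t - c) / (a1 t - 2 * t * ddt a1 t)" by blast
    have F: "natural_structure.curvature_factor a1 b1 t = c" if "t \<ge> 0" for t
      using b[OF that] unfolding F_iff by (simp add: field_simps)
    show "integrable_structure (cotangent_bundle A) (natural_J A g a1 a2 b1 b2)"
      unfolding integrable_structure_chart[OF A g nat]
      using c[unfolded constant_sectional_curvature_chart[OF A g]]
        F[OF local_metric.energy_nonneg[OF local_metric_chart[OF A g]]]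
      by (simp add: inner_diff_right mult.commute)
  next
    assume "integrable_structure (cotangent_bundle A) (natural_J A g a1 a2 b1 b2)"
    then have int: "p \<bullet> local_metric.Riem (metric_coeff A g \<alpha>) q u v w
        = natural_structure.curvature_factor a1 b1 (energy (metric_coeff A g \<alpha>) (q, p))
          * ((p \<bullet> u) * ((metric_coeff A g \<alpha> q *v v) \<bullet> w) - (p \<bullet> v) * ((metric_coeff A g \<alpha> q *v u) \<bullet> w))"
      if "q \<in> chart_img A \<alpha>" for \<alpha> q p u v w
      unfolding integrable_structure_chart[OF A g nat] using that by blast
    obtain c where c: "\<And>t. t > 0 \<Longrightarrow> natural_structure.curvature_factor a1 b1 t = c"
    proof -
      obtain \<alpha> q where q: "q \<in> chart_img A \<alpha>"
        using A by (auto simp: smooth_manifold_def points_def chart_img_def)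
      interpret L: local_metric "chart_img A \<alpha>" "metric_coeff A g \<alpha>" by (rule local_metric_chart[OF A g])
      define p :: "real^'n" where "p = axis undefined 1"
      have p: "p \<noteq> 0" by (simp add: p_def axis_eq_0_iff)
      \<comment> \<open>Dimension greater than one enters here. Because \<open>p\<close> annihilates
        \<open>v\<close>, the second product in the torsion condition vanishes.\<close>
      obtain v where v: "v \<noteq> 0" "p \<bullet> v = 0"
        using orthogonal_to_vector_exists[of p] assms(3) by (auto simp: orthogonal_def)
      let ?G = "metric_coeff A g \<alpha>"
      have vv: "(?G q *v v) \<bullet> v > 0" using L.pos_G[OF q v(1)] by (simp add: inner_commute)
      have E: "energy ?G (q, p) > 0"
      proof -
        have "L.Ginv q *v p \<noteq> 0" using p q by (metis L.G_Ginv matrix_vector_mult_0_right)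
        from L.pos_G[OF q this] show ?thesis using q by (simp add: L.energy_eq)
      qed
      \<comment> \<open>The condition is tested at the multiple of \<open>p\<close> with energy
        \<open>t\<close>, with \<open>u\<close> having the same components as \<open>p\<close>, so
        that \<open>p \<bullet> u\<close> is positive. Both sides carry the factor \<open>s\<close>;
        after cancelling it, the quotient no longer depends on \<open>t\<close>.\<close>
      have "natural_structure.curvature_factor a1 b1 t = (p \<bullet> L.Riem q p v v) / ((p \<bullet> p) * ((?G q *v v) \<bullet> v))" if "t > 0" for t
      proof -
        define s where "s = sqrt (t / energy ?G (q, p))"
        have s: "s > 0" using that E by (simp add: s_def)
        have "energy ?G (q, s *\<^sub>R p) = s\<^sup>2 * energy ?G (q, p)"
          by (simp add: L.energy_eq matrix_vector_mult_scaleR power2_eq_square)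
        also have "\<dots> = t" using that E by (simp add: s_def)
        finally have "s * (p \<bullet> L.Riem q p v v) = natural_structure.curvature_factor a1 b1 t * (s * (p \<bullet> p) * ((?G q *v v) \<bullet> v))"
          using int[OF q, of "s *\<^sub>R p" p v v] v(2) by simp
        then show ?thesis using s vv p by (simp add: field_simps)
      qed
      then show ?thesis using that by blast
    qed
    \<comment> \<open>Rescaling reaches only \<open>t > 0\<close>, as the condition is void at the
      zero covector; the value at 0 follows by continuity.\<close>
    have "continuous_on {0..} (natural_structure.curvature_factor a1 b1)"
      unfolding F_def[abs_def]
      using assms(4,6) by (intro continuous_intros continuous_on_ddt differentiable_imp_continuous_on
          smooth_on_halfline_differentiable)
    then have F: "natural_structure.curvature_factor a1 b1 t = c" if "t \<ge> 0" for t
      using continuous_constant_on_closure[of "{0<..}" "natural_structure.curvature_factor a1 b1" c t] that c by simp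
    \<comment> \<open>With \<open>F\<close> constant, the condition for all \<open>p\<close> is
      equality of all inner products with two vectors. The constant found in one chart works in
      each, because \<open>F\<close> involves no chart.\<close>
    have "local_metric.Riem (metric_coeff A g \<alpha>) q u v w
      = c *\<^sub>R (((metric_coeff A g \<alpha> q *v v) \<bullet> w) *\<^sub>R u - ((metric_coeff A g \<alpha> q *v u) \<bullet> w) *\<^sub>R v)"
      if q: "q \<in> chart_img A \<alpha>" for \<alpha> q u v w
      by (rule vector_eq_ldot[THEN iffD1])
         (simp add: int[OF q] F local_metric.energy_nonneg[OF local_metric_chart[OF A g] q] inner_diff_right mult.commute)
    then have "constant_sectional_curvature A g c"
      unfolding constant_sectional_curvature_chart[OF A g] by blast
    moreover have "a1 t - 2 * t * ddt a1 t \<noteq> 0" if "t \<ge> 0" for t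
      using denominator_nonzero[of a1 b1 c t] assms(4,6,10,12) F[unfolded F_def] that
        smooth_on_halfline_differentiable differentiable_imp_continuous_on by blast
    ultimately show "\<exists>c. constant_sectional_curvature A g c \<and>
         (\<forall>t\<ge>0. a1 t - 2 * t * ddt a1 t \<noteq> 0 \<and>
                b1 t = (a1 t * ddt a1 t - c) / (a1 t - 2 * t * ddt a1 t))"
      using F[unfolded F_iff] by (intro exI[of _ c]) (auto simp: field_simps)
  qed
qed

end
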